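(* There is an absolute constant $C>0$ such that for all real $T,z\ge 2$ and all complex sequences $(a_n)_{n\ge1}$, $(b_m)_{m\ge1}$ with $|a_n|,|b_m|\le 1$, \[ \Bigg|\sum_{\substack{n,m \text{ odd, square-free}\\ z<n\le T,\ z<m\le T\\ nm\le T}} a_n b_m \Big(\frac{n}{m}\Big)\Bigg|\le C\,\frac{T\log T}{z^{1/4}}. \]
   Context: $\big(\frac{n}{m}\big)$ denotes the Jacobi symbol, defined for integers $n$ and odd positive integers $m$. The sum runs over pairs $(n,m)$ of positive integers that are both odd and square-free. *)

theory Defs
  imports Complex_Main "HOL-Number_Theory.Quadratic_Reciprocity"
    "HOL-Computational_Algebra.Squarefree"
begin

text \<open>
  The Jacobi symbol, as the product of the Legendre symbols over the prime factors
  of the modulus counted with multiplicity. It is meaningful only for odd positive \<open>m\<close>.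
\<close>

definition Jacobi :: "int \<Rightarrow> nat \<Rightarrow> int" where
  "Jacobi n m = (\<Prod>p\<in>#prime_factorization m. Legendre n (int p))"

end

theory Submission
  imports Defs "HOL-Analysis.Harmonic_Numbers"
begin

text \<open>
  Over a rectangle, Cauchy--Schwarz in \<open>m\<close> and then in the product \<open>n n'\<close> of two values of \<open>n\<close>
  bounds the fourth power of the sum by the multiplicative energy of the range of \<open>n\<close> times the mean
  square of \<open>\<Sum>\<^sub>m (k/m)\<close> over \<open>k = n n'\<close>. Opening the square and smoothing the range of \<open>k\<close> leaves
  bilinear forms with kernel \<open>((s+t)/m) ((s+t)/m')\<close>, and square root cancellation for them needs no Gauss
  sums: for a prime modulus \<open>p\<close> the correlations of the Legendre symbol give operator norm at
  most \<open>\<surd>p\<close>, and norms multiply over coprime moduli. The diagonal dominates when \<open>n\<close> is the longer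
  variable; this gives a saving \<open>m\<^bsup>-1/4\<^esup>\<close> at the cost of one logarithm. The region under the hyperbola is
  exhausted by rectangles shrinking dyadically, and the range where \<open>m\<close> is longer is
  reduced to the other one by quadratic reciprocity.
\<close>

section \<open>The Jacobi symbol\<close>

text \<open>The fourth power fixes the exponent. For \<open>K\<close> values of m and
  \<open>L\<close> values of n up to \<open>V\<close>, the energy is about L^2 and the mean square
  of the sums over m about V L K, so the fourth power of the sum is at most about K^2 * L^2 * V L K.
  With K = M and L = V = N / M this is N^4 / M, times the fourth power of a logarithm: the saving is
  M^(-1/4), and one logarithm survives the fourth root. The obstacle is the condition n m <= N,
  which couples the variables. A rectangle of width K under the hyperbola has L about K N / M^2, so
  its bound is of order K^(3/2) N / M^(7/4): halving K gains 2^(-3/2) while the number of rectangles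
  only doubles. This convergence is the reason why the gcd sums and the energy are bounded by the
  length of the interval and not by its endpoint. With V in place of L in the energy the bound would
  be of order K, every scale would contribute equally, and a second logarithm would appear.\<close>

lemma Legendre_cong:
  assumes "[a = b] (mod p)"
  shows "Legendre a p = Legendre b p"
proof -
  have "[a = 0] (mod p) \<longleftrightarrow> [b = 0] (mod p)"
    using assms cong_sym cong_trans by blast
  moreover have "QuadRes p a \<longleftrightarrow> QuadRes p b"
    unfolding QuadRes_def using assms cong_sym cong_trans by blast
  ultimately show ?thesis by (simp add: Legendre_def)
qed

lemma abs_Legendre_le_1: "\<bar>Legendre a p\<bar> \<le> 1"
  by (simp add: Legendre_def)

lemma cong_imp_eq_if_abs_le_1:
  fixes p u v :: int
  assumes "2 < p" "\<bar>u\<bar> \<le> 1" "\<bar>v\<bar> \<le> 1" "[u = v] (mod p)"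
  shows "u = v"
proof -
  have "p dvd u - v" using assms(4) by (simp add: cong_iff_dvd_diff)
  moreover have "\<bar>u - v\<bar> < p" using assms by linarith
  ultimately show ?thesis
    using zdvd_imp_le[of p "\<bar>u - v\<bar>"] by fastforce
qed

text \<open>Euler's criterion gives the identity modulo \<open>p\<close>; both sides lie in {-1, 0,
  1}, and for \<open>p > 2\<close> a congruence between such numbers is an equality.\<close>

lemma Legendre_mult:
  fixes p :: nat
  assumes "prime p" "2 < p"
  shows "Legendre (a * b) p = Legendre a p * Legendre b p"
proof (rule cong_imp_eq_if_abs_le_1)
  show "2 < int p" using assms by simp
  show "\<bar>Legendre (a * b) (int p)\<bar> \<le> 1" by (rule abs_Legendre_le_1)
  show "\<bar>Legendre a (int p) * Legendre b (int p)\<bar> \<le> 1"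
    by (simp add: Legendre_def)
  have "[Legendre (a * b) p = (a * b) ^ ((p - 1) div 2)] (mod p)"
    by (rule euler_criterion[OF assms])
  moreover have "[Legendre a p * Legendre b p = a ^ ((p - 1) div 2) * b ^ ((p - 1) div 2)] (mod p)"
    by (intro cong_mult euler_criterion assms)
  ultimately show "[Legendre (a * b) (int p) = Legendre a (int p) * Legendre b (int p)] (mod int p)"
    by (simp add: power_mult_distrib) (meson cong_sym cong_trans)
qed

lemma Jacobi_1 [simp]: "Jacobi n (Suc 0) = 1"
  by (simp add: Jacobi_def)

lemma Jacobi_prime: "prime p \<Longrightarrow> Jacobi n p = Legendre n (int p)"
  by (simp add: Jacobi_def prime_factorization_prime)

lemma Jacobi_mult_right:
  assumes "m > 0" "k > 0"
  shows "Jacobi n (m * k) = Jacobi n m * Jacobi n k"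
  using assms by (simp add: Jacobi_def prime_factorization_mult)

lemma prime_factor_odd_gt_2:
  fixes m :: nat
  assumes "odd m" "p \<in># prime_factorization m"
  shows "prime p" "2 < p"
proof -
  show *: "prime p" using assms by auto
  have "p dvd m" using assms by auto
  with assms(1) have "odd p" using dvd_trans by blast
  with * show "2 < p" using prime_gt_1_nat[of p] by (cases "p = 2") auto
qed

lemma Jacobi_mult_left:
  assumes "odd m"
  shows "Jacobi (a * b) m = Jacobi a m * Jacobi b m"
proof -
  have "image_mset (\<lambda>p. Legendre (a * b) (int p)) (prime_factorization m)
      = image_mset (\<lambda>p. Legendre a (int p) * Legendre b (int p)) (prime_factorization m)"
    using assms by (intro image_mset_cong Legendre_mult prime_factor_odd_gt_2)
  then show ?thesis by (simp add: Jacobi_def prod_mset.distrib)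
qed

lemma Jacobi_cong:
  assumes "[a = b] (mod int m)"
  shows "Jacobi a m = Jacobi b m"
proof -
  have "image_mset (\<lambda>p. Legendre a (int p)) (prime_factorization m)
      = image_mset (\<lambda>p. Legendre b (int p)) (prime_factorization m)"
  proof (intro image_mset_cong Legendre_cong)
    fix p assume "p \<in># prime_factorization m"
    then have "int p dvd int m" by auto
    with assms show "[a = b] (mod int p)" by (rule cong_dvd_modulus)
  qed
  then show ?thesis by (simp add: Jacobi_def)
qed

lemma abs_Jacobi_le_1: "\<bar>Jacobi a m\<bar> \<le> 1"
proof -
  have "\<bar>\<Prod>p\<in>#M. Legendre a (int p)\<bar> \<le> 1" for M
  proof (induction M)
    case (add p M)
    then show ?case using abs_Legendre_le_1[of a "int p"]
      by (simp add: abs_mult mult_le_one)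
  qed simp
  then show ?thesis by (simp add: Jacobi_def)
qed

lemma Jacobi_one_left:
  assumes "odd m"
  shows "Jacobi 1 m = 1"
proof -
  have "Legendre 1 (int p) = 1" if "p > 2" for p
  proof -
    have "\<not> [1 = 0] (mod int p)" using that by (simp add: cong_0_iff)
    moreover have "QuadRes (int p) 1" unfolding QuadRes_def by (intro exI[of _ 1]) simp
    ultimately show ?thesis by (simp add: Legendre_def)
  qed
  then have "image_mset (\<lambda>p. Legendre 1 (int p)) (prime_factorization m)
      = image_mset (\<lambda>p. 1) (prime_factorization m)"
    using assms by (intro image_mset_cong) (auto dest: prime_factor_odd_gt_2(2))
  then show ?thesis by (simp add: Jacobi_def)
qed

text \<open>For odd arguments this is (-1)^((n-1)/2 * (m-1)/2). Written with residues modulo 4, its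
  multiplicativity becomes a finite check.\<close>

definition reciprocity_sign :: "nat \<Rightarrow> nat \<Rightarrow> int" where
  "reciprocity_sign n m = (if n mod 4 = 3 \<and> m mod 4 = 3 then - 1 else 1)"

lemma reciprocity_sign_mult:
  assumes "odd m" "odd n"
  shows "reciprocity_sign (m * n) k = reciprocity_sign m k * reciprocity_sign n k"
    and "reciprocity_sign k (m * n) = reciprocity_sign k m * reciprocity_sign k n"
proof -
  have *: "m mod 4 = 1 \<or> m mod 4 = 3" "n mod 4 = 1 \<or> n mod 4 = 3"
    using assms by presburger+
  moreover have "(m * n) mod 4 = ((m mod 4) * (n mod 4)) mod 4" by (simp add: mod_mult_eq)
  ultimately show "reciprocity_sign (m * n) k = reciprocity_sign m k * reciprocity_sign n k"
    "reciprocity_sign k (m * n) = reciprocity_sign k m * reciprocity_sign k n"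
    by (auto simp: reciprocity_sign_def)
qed

lemma Legendre_reciprocity:
  fixes p q :: nat
  assumes "prime p" "2 < p" "prime q" "2 < q"
  shows "Legendre p q = reciprocity_sign p q * Legendre q p"
proof (cases "p = q")
  case True
  then show ?thesis by (simp add: Legendre_def cong_0_iff)
next
  case False
  \<comment> \<open>For distinct primes both symbols are signs, so the law for their product can be
    solved for one of them; for equal primes both vanish.\<close>
  have nz: "Legendre (int r) (int s) \<in> {1, -1}" if "prime r" "prime s" "r \<noteq> s" for r s :: nat
  proof -
    have "\<not> s dvd r" using that by (metis primes_dvd_imp_eq)
    then have "\<not> [int r = 0] (mod int s)" by (simp add: cong_0_iff)
    then show ?thesis by (simp add: Legendre_def)
  qed
  have "odd p" "odd q" using assms prime_odd_nat by auto
  have "Legendre p q * Legendre q p = (-1::int) ^ ((p - 1) div 2 * ((q - 1) div 2))"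
    using Quadratic_Reciprocity assms False by blast
  also have "\<dots> = reciprocity_sign p q"
  proof -
    have "even ((r - 1) div 2) \<longleftrightarrow> r mod 4 \<noteq> 3" if "odd r" for r :: nat
      using that by presburger
    then have "even ((p - 1) div 2 * ((q - 1) div 2)) \<longleftrightarrow> \<not> (p mod 4 = 3 \<and> q mod 4 = 3)"
      using \<open>odd p\<close> \<open>odd q\<close> by simp
    then show ?thesis by (auto simp: reciprocity_sign_def)
  qed
  finally show ?thesis using nz[of p q] nz[of q p] assms False
    by (auto simp: reciprocity_sign_def split: if_splits)
qed

text \<open>Reciprocity is extended one argument at a time: here the composite entry is built up
  prime by prime against a fixed prime, and the next lemma does the same in the other entry.\<close>

lemma Jacobi_reciprocity_prime:
  fixes p m :: nat
  assumes "prime p" "2 < p" "odd m"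
  shows "Jacobi (int m) p = reciprocity_sign m p * Jacobi (int p) m"
  using assms(3)
proof (induction m rule: prime_divisors_induct)
  case (factor q m)
  then have "odd q" "odd m" by auto
  moreover have "2 < q" using factor.hyps \<open>odd q\<close> prime_gt_1_nat[of q] by (cases "q = 2") auto
  moreover have "odd p" using assms prime_odd_nat by auto
  moreover have "m > 0" using \<open>odd m\<close> by (simp add: odd_pos)
  ultimately show ?case
    using factor.hyps factor.IH assms prime_gt_0_nat[of q]
    by (simp add: Jacobi_mult_left Jacobi_mult_right reciprocity_sign_mult Jacobi_prime
        Legendre_reciprocity[of q p] Legendre_mult[of p])
qed (use assms in \<open>auto simp: reciprocity_sign_def Jacobi_one_left prime_odd_nat\<close>)

lemma Jacobi_reciprocity:
  fixes n m :: nat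
  assumes "odd n" "odd m"
  shows "Jacobi (int n) m = reciprocity_sign n m * Jacobi (int m) n"
  using assms(2)
proof (induction m rule: prime_divisors_induct)
  case (factor p m)
  then have "odd p" "odd m" by auto
  moreover have "2 < p" using factor.hyps \<open>odd p\<close> prime_gt_1_nat[of p] by (cases "p = 2") auto
  moreover have "m > 0" using \<open>odd m\<close> by (simp add: odd_pos)
  ultimately show ?case
    using factor.hyps factor.IH assms(1) prime_gt_0_nat[of p] Jacobi_reciprocity_prime[of p n]
    by (simp add: Jacobi_mult_left Jacobi_mult_right reciprocity_sign_mult)
qed (use assms in \<open>auto simp: reciprocity_sign_def Jacobi_one_left\<close>)

section \<open>Operator norms of periodic convolution kernels\<close>

definition periodic :: "(int \<Rightarrow> 'a) \<Rightarrow> int \<Rightarrow> bool" where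
  "periodic \<psi> Q \<longleftrightarrow> (\<forall>x. \<psi> (x mod Q) = \<psi> x)"

text \<open>\<open>C\<close> bounds the square of the l2 operator norm of the matrix
  \<open>\<psi> (a + b)\<close> over the residues modulo \<open>Q\<close>. The sum
  \<open>a + b\<close> matches the averaging over \<open>t + w\<close> in the mean value
  estimate.\<close>

definition kernel_norm :: "(int \<Rightarrow> real) \<Rightarrow> int \<Rightarrow> real \<Rightarrow> bool" where
  "kernel_norm \<psi> Q C \<longleftrightarrow> Q > 0 \<and> C \<ge> 0 \<and> periodic \<psi> Q \<and>
    (\<forall>f. (\<Sum>a\<in>{0..<Q}. (\<Sum>b\<in>{0..<Q}. f b * \<psi> (a + b))\<^sup>2) \<le> C * (\<Sum>b\<in>{0..<Q}. (f b)\<^sup>2))"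

lemma periodicD: "periodic \<psi> Q \<Longrightarrow> \<psi> (x mod Q) = \<psi> x"
  by (simp add: periodic_def)

lemma periodic_cong: "periodic \<psi> Q \<Longrightarrow> [x = y] (mod Q) \<Longrightarrow> \<psi> x = \<psi> y"
  unfolding periodic_def unique_euclidean_semiring_class.cong_def by metis

lemma periodicI: "(\<And>x y. [x = y] (mod Q) \<Longrightarrow> \<psi> x = \<psi> y) \<Longrightarrow> periodic \<psi> Q"
  unfolding periodic_def by (metis cong_mod_left cong_refl)

lemma periodic_dvd: "periodic \<psi> Q \<Longrightarrow> Q dvd R \<Longrightarrow> periodic \<psi> R"
  by (meson cong_dvd_modulus periodicI periodic_cong)

lemma sum_periodic_affine:
  fixes \<psi> :: "int \<Rightarrow> real"
  assumes Q: "Q > 0" and per: "periodic \<psi> Q" and d: "coprime d Q"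
  shows "(\<Sum>x\<in>{0..<Q}. \<psi> (d * x + c)) = (\<Sum>x\<in>{0..<Q}. \<psi> x)"
proof -
  have inj: "inj_on (\<lambda>x. (d * x + c) mod Q) {0..<Q}"
  proof (rule inj_onI)
    fix x y assume xy: "x \<in> {0..<Q}" "y \<in> {0..<Q}" "(d * x + c) mod Q = (d * y + c) mod Q"
    then have "[d * x = d * y] (mod Q)"
      by (metis cong_add_rcancel unique_euclidean_semiring_class.cong_def)
    with d have "[x = y] (mod Q)" using cong_mult_lcancel by blast
    with xy show "x = y" by (simp add: unique_euclidean_semiring_class.cong_def)
  qed
  moreover have "(\<lambda>x. (d * x + c) mod Q) ` {0..<Q} \<subseteq> {0..<Q}" using Q by auto
  ultimately have "bij_betw (\<lambda>x. (d * x + c) mod Q) {0..<Q} {0..<Q}"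
    by (simp add: bij_betw_def endo_inj_surj)
  from sum.reindex_bij_betw[OF this, of \<psi>] show ?thesis
    using per by (simp add: periodicD)
qed

lemma sum_periodic_shift:
  fixes \<psi> :: "int \<Rightarrow> real"
  assumes "Q > 0" "periodic \<psi> Q"
  shows "(\<Sum>x\<in>{0..<Q}. \<psi> (x + c)) = (\<Sum>x\<in>{0..<Q}. \<psi> x)"
  using sum_periodic_affine[OF assms, of 1 c] by simp

text \<open>The Hilbert-Schmidt bound. It serves the kernels without cancellation: squares of
  symbols, which only indicate coprimality to the modulus.\<close>

lemma kernel_norm_trivial:
  assumes "Q > 0" "periodic \<psi> Q" "\<And>x. \<bar>\<psi> x\<bar> \<le> 1"
  shows "kernel_norm \<psi> Q (of_int Q ^ 2)"
  unfolding kernel_norm_def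
proof (intro conjI allI)
  fix f :: "int \<Rightarrow> real"
  have "(\<Sum>b\<in>{0..<Q}. f b * \<psi> (a + b))\<^sup>2 \<le> (\<Sum>b\<in>{0..<Q}. (f b)\<^sup>2) * of_int Q" for a
  proof -
    have "(\<psi> (a + b))\<^sup>2 \<le> 1" for b
      using assms(3)[of "a + b"] by (simp add: abs_square_le_1)
    then have "(\<Sum>b\<in>{0..<Q}. (\<psi> (a + b))\<^sup>2) \<le> of_int Q"
      using sum_bounded_above[of "{0..<Q}" "\<lambda>b. (\<psi> (a + b))\<^sup>2" 1] assms(1) by simp
    then have "(\<Sum>b\<in>{0..<Q}. (f b)\<^sup>2) * (\<Sum>b\<in>{0..<Q}. (\<psi> (a + b))\<^sup>2) \<le> (\<Sum>b\<in>{0..<Q}. (f b)\<^sup>2) * of_int Q"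
      by (intro mult_left_mono sum_nonneg) auto
    then show ?thesis
      using Cauchy_Schwarz_ineq_sum[of f "\<lambda>b. \<psi> (a + b)" "{0..<Q}"] by linarith
  qed
  then show "(\<Sum>a\<in>{0..<Q}. (\<Sum>b\<in>{0..<Q}. f b * \<psi> (a + b))\<^sup>2) \<le> of_int Q ^ 2 * (\<Sum>b\<in>{0..<Q}. (f b)\<^sup>2)"
    using sum_bounded_above[of "{0..<Q}" "\<lambda>a. (\<Sum>b\<in>{0..<Q}. f b * \<psi> (a + b))\<^sup>2"
        "(\<Sum>b\<in>{0..<Q}. (f b)\<^sup>2) * of_int Q"] assms(1)
    by (simp add: power2_eq_square mult_ac)
qed (use assms in auto)

lemma bij_betw_residues:
  fixes Q R :: int
  assumes "Q > 0" "R > 0" "coprime Q R"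
  shows "bij_betw (\<lambda>x. (x mod Q, x mod R)) {0..<Q * R} ({0..<Q} \<times> {0..<R})"
proof -
  have inj: "inj_on (\<lambda>x. (x mod Q, x mod R)) {0..<Q * R}"
  proof (rule inj_onI)
    fix x y assume xy: "x \<in> {0..<Q * R}" "y \<in> {0..<Q * R}" "(x mod Q, x mod R) = (y mod Q, y mod R)"
    then have "[x = y] (mod Q * R)"
      using assms(3) by (intro coprime_cong_mult) (auto simp: unique_euclidean_semiring_class.cong_def)
    with xy show "x = y" by (simp add: unique_euclidean_semiring_class.cong_def)
  qed
  moreover have "(\<lambda>x. (x mod Q, x mod R)) ` {0..<Q * R} = {0..<Q} \<times> {0..<R}"
  proof (rule card_subset_eq)
    show "card ((\<lambda>x. (x mod Q, x mod R)) ` {0..<Q * R}) = card ({0..<Q} \<times> {0..<R})"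
      using assms by (simp add: card_image[OF inj] nat_mult_distrib)
  qed (use assms in auto)
  ultimately show ?thesis by (simp add: bij_betw_def)
qed

text \<open>
  By the Chinese remainder theorem the kernel of a product is a tensor product, and the operator
  norm is multiplicative: apply the bound in one coordinate and then in the other.
\<close>

lemma kernel_norm_mult:
  assumes 1: "kernel_norm \<psi> Q C" and 2: "kernel_norm \<eta> R D" and "coprime Q R"
  shows "kernel_norm (\<lambda>x. \<psi> x * \<eta> x) (Q * R) (C * D)"
  unfolding kernel_norm_def
proof (intro conjI allI)
  have pos: "Q > 0" "R > 0" "C \<ge> 0" "D \<ge> 0" and per: "periodic \<psi> Q" "periodic \<eta> R"
    and C: "\<And>f. (\<Sum>a\<in>{0..<Q}. (\<Sum>b\<in>{0..<Q}. f b * \<psi> (a + b))\<^sup>2) \<le> C * (\<Sum>b\<in>{0..<Q}. (f b)\<^sup>2)"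
    and D: "\<And>f. (\<Sum>a\<in>{0..<R}. (\<Sum>b\<in>{0..<R}. f b * \<eta> (a + b))\<^sup>2) \<le> D * (\<Sum>b\<in>{0..<R}. (f b)\<^sup>2)"
    using 1 2 by (auto simp: kernel_norm_def)
  show "Q * R > 0" "C * D \<ge> 0" using pos by auto
  have "periodic \<psi> (Q * R)" "periodic \<eta> (Q * R)"
    using per by (auto intro: periodic_dvd)
  then show "periodic (\<lambda>x. \<psi> x * \<eta> x) (Q * R)" by (simp add: periodic_def)
  fix f :: "int \<Rightarrow> real"
  define \<phi> where "\<phi> = (\<lambda>x. (x mod Q, x mod R))"
  have bij: "bij_betw \<phi> {0..<Q * R} ({0..<Q} \<times> {0..<R})"
    unfolding \<phi>_def using pos assms(3) by (intro bij_betw_residues)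
  define h where "h = (\<lambda>b. f (inv_into {0..<Q * R} \<phi> b))"
  have h: "h (x mod Q, x mod R) = f x" if "x \<in> {0..<Q * R}" for x
    using inv_into_f_f[of \<phi> "{0..<Q * R}" x] bij that by (simp add: h_def \<phi>_def bij_betw_def)
  have reindex: "(\<Sum>x\<in>{0..<Q * R}. G (x mod Q) (x mod R)) = (\<Sum>y\<in>{0..<Q}. \<Sum>z\<in>{0..<R}. G y z)"
    for G :: "int \<Rightarrow> int \<Rightarrow> real"
    using sum.reindex_bij_betw[OF bij, of "\<lambda>(y, z). G y z"]
    by (simp add: \<phi>_def sum.cartesian_product)
  have inner: "(\<Sum>b\<in>{0..<Q * R}. f b * (\<psi> (a + b) * \<eta> (a + b)))
     = (\<Sum>y\<in>{0..<Q}. \<Sum>z\<in>{0..<R}. h (y, z) * (\<psi> (a mod Q + y) * \<eta> (a mod R + z)))" for a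
  proof -
    have "(\<Sum>b\<in>{0..<Q * R}. f b * (\<psi> (a + b) * \<eta> (a + b)))
        = (\<Sum>b\<in>{0..<Q * R}. h (b mod Q, b mod R) * (\<psi> (a mod Q + b mod Q) * \<eta> (a mod R + b mod R)))"
      by (intro sum.cong refl arg_cong2[of _ _ _ _ "(*)"] periodic_cong[OF per(1)] periodic_cong[OF per(2)])
         (auto simp: h unique_euclidean_semiring_class.cong_def mod_add_eq)
    also have "\<dots> = (\<Sum>y\<in>{0..<Q}. \<Sum>z\<in>{0..<R}. h (y, z) * (\<psi> (a mod Q + y) * \<eta> (a mod R + z)))"
      by (rule reindex)
    finally show ?thesis .
  qed
  have "(\<Sum>a\<in>{0..<Q * R}. (\<Sum>b\<in>{0..<Q * R}. f b * (\<psi> (a + b) * \<eta> (a + b)))\<^sup>2)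
     = (\<Sum>u\<in>{0..<Q}. \<Sum>v\<in>{0..<R}. (\<Sum>y\<in>{0..<Q}. \<Sum>z\<in>{0..<R}. h (y, z) * (\<psi> (u + y) * \<eta> (v + z)))\<^sup>2)"
    unfolding inner
    by (rule reindex[of "\<lambda>u v. (\<Sum>y\<in>{0..<Q}. \<Sum>z\<in>{0..<R}. h (y, z) * (\<psi> (u + y) * \<eta> (v + z)))\<^sup>2"])
  also have "\<dots> = (\<Sum>u\<in>{0..<Q}. \<Sum>v\<in>{0..<R}. (\<Sum>z\<in>{0..<R}. (\<Sum>y\<in>{0..<Q}. h (y, z) * \<psi> (u + y)) * \<eta> (v + z))\<^sup>2)"
  proof -
    have "(\<Sum>y\<in>{0..<Q}. \<Sum>z\<in>{0..<R}. h (y, z) * (\<psi> (u + y) * \<eta> (v + z)))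
      = (\<Sum>z\<in>{0..<R}. (\<Sum>y\<in>{0..<Q}. h (y, z) * \<psi> (u + y)) * \<eta> (v + z))" for u v
      by (subst sum.swap) (simp add: sum_distrib_right sum_distrib_left mult_ac)
    then show ?thesis by simp
  qed
  also have "\<dots> \<le> (\<Sum>u\<in>{0..<Q}. D * (\<Sum>z\<in>{0..<R}. (\<Sum>y\<in>{0..<Q}. h (y, z) * \<psi> (u + y))\<^sup>2))"
    by (intro sum_mono D)
  also have "\<dots> = D * (\<Sum>z\<in>{0..<R}. \<Sum>u\<in>{0..<Q}. (\<Sum>y\<in>{0..<Q}. h (y, z) * \<psi> (u + y))\<^sup>2)"
    by (subst sum.swap) (simp add: sum_distrib_left)
  also have "\<dots> \<le> D * (\<Sum>z\<in>{0..<R}. C * (\<Sum>y\<in>{0..<Q}. (h (y, z))\<^sup>2))"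
    using pos by (intro mult_left_mono sum_mono C)
  also have "\<dots> = C * D * (\<Sum>z\<in>{0..<R}. \<Sum>y\<in>{0..<Q}. (h (y, z))\<^sup>2)"
    by (simp add: sum_distrib_left mult_ac)
  also have "(\<Sum>z\<in>{0..<R}. \<Sum>y\<in>{0..<Q}. (h (y, z))\<^sup>2) = (\<Sum>b\<in>{0..<Q * R}. (h (b mod Q, b mod R))\<^sup>2)"
    by (subst sum.swap) (simp add: reindex[of "\<lambda>y z. (h (y, z))\<^sup>2"])
  also have "\<dots> = (\<Sum>b\<in>{0..<Q * R}. (f b)\<^sup>2)"
    by (intro sum.cong refl) (simp add: h)
  finally show "(\<Sum>a\<in>{0..<Q * R}. (\<Sum>b\<in>{0..<Q * R}. f b * (\<psi> (a + b) * \<eta> (a + b)))\<^sup>2)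
    \<le> C * D * (\<Sum>b\<in>{0..<Q * R}. (f b)\<^sup>2)" .
qed

section \<open>Legendre and Jacobi symbols as kernels\<close>

lemma periodic_Jacobi: "periodic (\<lambda>x. real_of_int (Jacobi x m)) (int m)"
  by (intro periodicI) (simp add: Jacobi_cong)

lemma periodic_Legendre: "periodic (\<lambda>x. real_of_int (Legendre x p)) p"
  by (intro periodicI) (simp add: Legendre_cong)

text \<open>Otherwise squaring would be surjective, hence injective, on the residues modulo
  \<open>p\<close>; but 1 and \<open>p - 1\<close> have the same square.\<close>

lemma ex_nonresidue:
  fixes p :: nat
  assumes "prime p" "2 < p"
  shows "\<exists>d. Legendre d p = -1"
proof (rule ccontr)
  assume "\<not> ?thesis"
  then have *: "QuadRes p d" if "d \<in> {0..<int p}" for d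
    using that by (auto simp: Legendre_def QuadRes_def cong_0_iff intro: exI[of _ 0] split: if_splits)
       (metis cong_0_iff cong_sym power_zero_numeral)
  have "{0..<int p} \<subseteq> (\<lambda>x. x\<^sup>2 mod int p) ` {0..<int p}"
  proof
    fix d assume d: "d \<in> {0..<int p}"
    then obtain y where "[y\<^sup>2 = d] (mod int p)" using * by (auto simp: QuadRes_def)
    then have "(y mod int p)\<^sup>2 mod int p = d"
      using d by (simp add: unique_euclidean_semiring_class.cong_def power_mod)
    moreover have "y mod int p \<in> {0..<int p}" using assms by simp
    ultimately show "d \<in> (\<lambda>x. x\<^sup>2 mod int p) ` {0..<int p}" by blast
  qed
  then have "card {0..<int p} \<le> card ((\<lambda>x. x\<^sup>2 mod int p) ` {0..<int p})"
    by (intro card_mono) auto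
  then have "inj_on (\<lambda>x. x\<^sup>2 mod int p) {0..<int p}"
    by (intro eq_card_imp_inj_on antisym card_image_le) auto
  moreover have "1\<^sup>2 mod int p = (int p - 1)\<^sup>2 mod int p"
  proof -
    have "[(int p - 1)\<^sup>2 = 1\<^sup>2] (mod int p)"
      by (simp add: cong_iff_dvd_diff power2_eq_square algebra_simps)
    then show ?thesis by (simp add: unique_euclidean_semiring_class.cong_def)
  qed
  ultimately have "1 = int p - 1" using assms by (auto dest!: inj_onD[of _ _ 1 "int p - 1"])
  then show False using assms by simp
qed

text \<open>The correlation of the translates by \<open>b\<close> and \<open>c\<close> is
  \<open>p\<close> times the Kronecker delta, minus 1. So the Gram matrix is p times the identity
  minus the all-ones matrix, and the subtracted part contributes the nonpositive term -(sum of
  f)^2.\<close>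

lemma kernel_norm_Legendre:
  fixes p :: nat
  assumes p: "prime p" "2 < p"
  shows "kernel_norm (\<lambda>x. real_of_int (Legendre x p)) (int p) (real p)"
proof -
  define \<eta> where "\<eta> = (\<lambda>x. real_of_int (Legendre x p))"
  have per: "periodic \<eta> (int p)" unfolding \<eta>_def by (rule periodic_Legendre)
  have pos: "int p > 0" using p by simp
  have mult: "\<eta> (x * y) = \<eta> x * \<eta> y" for x y by (simp add: \<eta>_def Legendre_mult p)
  have zero: "\<eta> x = 0 \<longleftrightarrow> int p dvd x" for x by (auto simp: \<eta>_def Legendre_def cong_0_iff)
  have sq: "\<eta> x * \<eta> x = (if int p dvd x then 0 else 1)" for x
    by (auto simp: \<eta>_def Legendre_def cong_0_iff)
  have cop: "coprime d (int p)" if "\<not> int p dvd d" for d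
    using prime_imp_coprime[of "int p" d] that p(1) by (simp add: coprime_commute)
  \<comment> \<open>Multiplication by a nonresidue permutes the residues and flips the sign of every
    term.\<close>
  have sum0: "(\<Sum>x\<in>{0..<int p}. \<eta> x) = 0"
  proof -
    obtain d where "Legendre d p = -1" using ex_nonresidue[OF p] by blast
    then have d: "\<eta> d = -1" by (simp add: \<eta>_def)
    then have "coprime d (int p)" using zero[of d] by (intro cop) auto
    from sum_periodic_affine[OF pos per this, of 0]
    have "(\<Sum>x\<in>{0..<int p}. \<eta> x) = (\<Sum>x\<in>{0..<int p}. - \<eta> x)" by (simp add: mult d)
    then show ?thesis by (simp add: sum_negf)
  qed
  have residues_eq: "{0..<int p} = insert 0 {1..<int p}" using p by auto
  define T where "T = (\<lambda>d. \<Sum>x\<in>{0..<int p}. \<eta> x * \<eta> (x + d))"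
  have sqsum: "(\<Sum>x\<in>{0..<int p}. \<eta> x * \<eta> x) = real p - 1"
  proof -
    have "(\<Sum>x\<in>{1..<int p}. \<eta> x * \<eta> x) = (\<Sum>x\<in>{1..<int p}. 1)"
      by (intro sum.cong refl) (auto simp: sq dest: zdvd_imp_le)
    then show ?thesis using p by (simp add: residues_eq sq of_nat_diff)
  qed
  have T_const: "T d = T 1" if d: "\<not> int p dvd d" for d
  proof -
    have per': "periodic (\<lambda>x. \<eta> x * \<eta> (x + d)) (int p)"
      by (intro periodicI arg_cong2[of _ _ _ _ "(*)"] periodic_cong[OF per] cong_add) auto
    have "T d = (\<Sum>x\<in>{0..<int p}. \<eta> (d * x) * \<eta> (d * x + d))"
      using sum_periodic_affine[OF pos per' cop[OF d], of 0] by (simp add: T_def)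
    also have "\<dots> = (\<Sum>x\<in>{0..<int p}. (\<eta> d * \<eta> d) * (\<eta> x * \<eta> (x + 1)))"
    proof (intro sum.cong refl)
      fix x
      have "d * x + d = d * (x + 1)" by (simp add: algebra_simps)
      then show "\<eta> (d * x) * \<eta> (d * x + d) = (\<eta> d * \<eta> d) * (\<eta> x * \<eta> (x + 1))"
        by (simp only: mult) simp
    qed
    also have "\<dots> = T 1" using d by (simp add: sq T_def)
    finally show ?thesis .
  qed
  \<comment> \<open>All correlations together give the square of the full sum of
    \<open>\<eta>\<close>, which is 0. Since \<open>T 0 = p - 1\<close> and the other
    \<open>p - 1\<close> values coincide, each of these is -1.\<close>
  have "T 0 + (\<Sum>d\<in>{1..<int p}. T d) = (\<Sum>d\<in>{0..<int p}. T d)"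
    by (simp add: residues_eq)
  also have "(\<Sum>d\<in>{0..<int p}. T d) = 0"
  proof -
    have "(\<Sum>d\<in>{0..<int p}. T d) = (\<Sum>x\<in>{0..<int p}. \<eta> x * (\<Sum>d\<in>{0..<int p}. \<eta> (d + x)))"
      unfolding T_def by (subst sum.swap) (simp add: sum_distrib_left add.commute)
    also have "\<dots> = 0" by (simp add: sum_periodic_shift[OF pos per] sum0)
    finally show ?thesis .
  qed
  finally have "T 0 + (\<Sum>d\<in>{1..<int p}. T d) = 0" .
  moreover have "(\<Sum>d\<in>{1..<int p}. T d) = (\<Sum>d\<in>{1..<int p}. T 1)"
    using p by (intro sum.cong refl T_const) (auto dest: zdvd_imp_le)
  moreover have "T 0 = real p - 1" by (simp add: T_def sqsum)
  ultimately have "(real p - 1) * (1 + T 1) = 0" using p by (simp add: algebra_simps of_nat_diff)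
  then have "T 1 = -1" using p by simp
  then have T: "T d = (if int p dvd d then real p else 0) - 1" for d
  proof (cases "int p dvd d")
    case True
    then have "\<eta> (x + d) = \<eta> x" for x
      by (intro periodic_cong[OF per]) (simp add: cong_iff_dvd_diff)
    then show ?thesis using True sqsum by (simp add: T_def)
  qed (simp add: T_const)
  have corr: "(\<Sum>a\<in>{0..<int p}. \<eta> (a + b) * \<eta> (a + c)) = (if b = c then real p else 0) - 1"
    if "b \<in> {0..<int p}" "c \<in> {0..<int p}" for b c
  proof -
    have per': "periodic (\<lambda>x. \<eta> x * \<eta> (x + (c - b))) (int p)"
      by (intro periodicI arg_cong2[of _ _ _ _ "(*)"] periodic_cong[OF per] cong_add) auto
    have "(\<Sum>a\<in>{0..<int p}. \<eta> (a + b) * \<eta> (a + c)) = T (c - b)"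
      using sum_periodic_shift[OF pos per', of b] by (simp add: T_def)
    moreover have "int p dvd c - b \<longleftrightarrow> b = c"
      using that by (metis atLeastLessThan_iff cong_iff_dvd_diff cong_less_imp_eq_int cong_refl)
    ultimately show ?thesis by (simp add: T)
  qed
  have "(\<Sum>a\<in>{0..<int p}. (\<Sum>b\<in>{0..<int p}. f b * \<eta> (a + b))\<^sup>2) \<le> real p * (\<Sum>b\<in>{0..<int p}. (f b)\<^sup>2)" for f
  proof -
    have "(\<Sum>a\<in>{0..<int p}. (\<Sum>b\<in>{0..<int p}. f b * \<eta> (a + b))\<^sup>2)
       = (\<Sum>a\<in>{0..<int p}. \<Sum>b\<in>{0..<int p}. \<Sum>c\<in>{0..<int p}. f b * f c * (\<eta> (a + b) * \<eta> (a + c)))"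
      by (simp add: power2_eq_square sum_product mult_ac)
    also have "\<dots> = (\<Sum>b\<in>{0..<int p}. \<Sum>a\<in>{0..<int p}. \<Sum>c\<in>{0..<int p}. f b * f c * (\<eta> (a + b) * \<eta> (a + c)))"
      by (rule sum.swap)
    also have "\<dots> = (\<Sum>b\<in>{0..<int p}. \<Sum>c\<in>{0..<int p}. f b * f c * (\<Sum>a\<in>{0..<int p}. \<eta> (a + b) * \<eta> (a + c)))"
      unfolding sum_distrib_left by (rule sum.cong[OF refl]) (rule sum.swap)
    also have "\<dots> = (\<Sum>b\<in>{0..<int p}. \<Sum>c\<in>{0..<int p}. (if b = c then real p * (f b)\<^sup>2 else 0) - f b * f c)"
      by (intro sum.cong refl, subst corr) (auto simp: power2_eq_square algebra_simps)
    also have "\<dots> = real p * (\<Sum>b\<in>{0..<int p}. (f b)\<^sup>2) - (\<Sum>b\<in>{0..<int p}. f b)\<^sup>2"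
      by (simp add: sum_subtractf power2_eq_square flip: sum_distrib_left sum_distrib_right)
    finally show ?thesis by simp
  qed
  then show ?thesis using pos per by (simp add: kernel_norm_def \<eta>_def)
qed

lemma squarefree_mult_imp_coprime:
  fixes m n :: nat
  assumes "squarefree (m * n)"
  shows "coprime m n"
proof (rule coprimeI)
  fix d assume "d dvd m" "d dvd n"
  then have "d\<^sup>2 dvd m * n" by (simp add: mult_dvd_mono power2_eq_square)
  with assms show "is_unit d" by (rule squarefreeD)
qed

text \<open>Square-freeness keeps each new prime factor coprime to the rest, as the tensor product
  requires.\<close>

lemma kernel_norm_Jacobi:
  assumes "odd m" "squarefree m"
  shows "kernel_norm (\<lambda>x. real_of_int (Jacobi x m)) (int m) (real m)"
  using assms
proof (induction m rule: prime_divisors_induct)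
  case (unit m)
  then show ?case
    using kernel_norm_trivial[of 1 "\<lambda>x. 1"] by (simp add: periodic_def)
next
  case (factor p m)
  have "coprime p m" using factor.prems(2) by (rule squarefree_mult_imp_coprime)
  have "odd p" "odd m" "squarefree m" using factor.prems by (auto dest: squarefree_multD)
  have "2 < p" using factor.hyps \<open>odd p\<close> prime_gt_1_nat[of p] by (cases "p = 2") auto
  have "m > 0" using \<open>odd m\<close> by (simp add: odd_pos)
  have "kernel_norm (\<lambda>x. real_of_int (Legendre x (int p)) * real_of_int (Jacobi x m))
      (int p * int m) (real p * real m)"
    using \<open>coprime p m\<close> \<open>2 < p\<close> \<open>odd m\<close> \<open>squarefree m\<close> factor
    by (intro kernel_norm_mult kernel_norm_Legendre factor.IH) auto
  moreover have "Jacobi x (p * m) = Legendre x (int p) * Jacobi x m" for x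
    using factor.hyps \<open>m > 0\<close> prime_gt_0_nat[of p]
    by (simp add: Jacobi_mult_right Jacobi_prime)
  ultimately show ?case by simp
qed simp

text \<open>Let \<open>m = g * k\<close> and \<open>n = g * l\<close> with \<open>g\<close> the gcd.
  Modulo \<open>g\<close> the kernel is a square and only the trivial \<open>g^2\<close> is
  available; \<open>k\<close> and \<open>l\<close> are coprime and contribute \<open>k * l\<close>
  with full cancellation. Altogether this is \<open>g^2 * k * l = m * n\<close>, for the modulus
  \<open>g * k * l\<close>, which is the lcm.\<close>

lemma kernel_norm_Jacobi_mult:
  assumes m: "odd m" "squarefree m" and n: "odd n" "squarefree n"
  shows "kernel_norm (\<lambda>x. real_of_int (Jacobi x m * Jacobi x n)) (int (lcm m n)) (real (m * n))"
proof -
  have "m > 0" "n > 0" using m n by (auto simp: odd_pos)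
  define g where "g = gcd m n"
  obtain k l where kl: "m = g * k" "n = g * l" by (metis dvd_def g_def gcd_dvd1 gcd_dvd2)
  have "g > 0" "k > 0" "l > 0" using \<open>m > 0\<close> \<open>n > 0\<close> kl by (auto intro!: Nat.gr0I)
  have "coprime k l" using kl g_def \<open>g > 0\<close>
    by (metis gcd_mult_distrib_nat mult.right_neutral coprime_iff_gcd_eq_1 mult_cancel1 neq0_conv)
  have "coprime g k" "coprime g l" using kl m n by (auto intro: squarefree_mult_imp_coprime)
  have "odd k" "odd l" "squarefree k" "squarefree l" "odd g" "squarefree g"
    using kl m n by (auto dest: squarefree_multD)
  have "periodic (\<lambda>x. real_of_int (Jacobi x g * Jacobi x g)) (int g)"
    using periodic_Jacobi[of g] by (simp add: periodic_def)
  moreover have "\<bar>real_of_int (Jacobi x g * Jacobi x g)\<bar> \<le> 1" for x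
  proof -
    have "\<bar>Jacobi x g\<bar> * \<bar>Jacobi x g\<bar> \<le> 1" using abs_Jacobi_le_1[of x g] by (intro mult_le_one) auto
    then have "\<bar>Jacobi x g * Jacobi x g\<bar> \<le> 1" by (simp only: abs_mult)
    then show ?thesis by linarith
  qed
  ultimately have "kernel_norm (\<lambda>x. real_of_int (Jacobi x g * Jacobi x g)) (int g) (of_int (int g) ^ 2)"
    using \<open>g > 0\<close> by (intro kernel_norm_trivial) auto
  moreover have "kernel_norm (\<lambda>x. real_of_int (Jacobi x k) * real_of_int (Jacobi x l)) (int k * int l) (real k * real l)"
    using \<open>odd k\<close> \<open>odd l\<close> \<open>squarefree k\<close> \<open>squarefree l\<close> \<open>coprime k l\<close>
    by (intro kernel_norm_mult kernel_norm_Jacobi) auto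
  moreover have "coprime (int g) (int k * int l)"
    using \<open>coprime g k\<close> \<open>coprime g l\<close> by auto
  ultimately have "kernel_norm (\<lambda>x. real_of_int (Jacobi x g * Jacobi x g) * (real_of_int (Jacobi x k) * real_of_int (Jacobi x l)))
     (int g * (int k * int l)) (of_int (int g) ^ 2 * (real k * real l))"
    by (rule kernel_norm_mult)
  moreover have "lcm m n = g * (k * l)"
  proof -
    have "m * n = g * lcm m n" unfolding g_def by (rule prod_gcd_lcm_nat)
    then have "g * (g * (k * l)) = g * lcm m n" by (simp add: kl mult_ac)
    then show ?thesis using \<open>g > 0\<close> by simp
  qed
  moreover have "Jacobi x m * Jacobi x n = Jacobi x g * Jacobi x g * (Jacobi x k * Jacobi x l)" for x
    using \<open>g > 0\<close> \<open>k > 0\<close> \<open>l > 0\<close> by (simp add: kl Jacobi_mult_right mult_ac)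
  ultimately show ?thesis by (simp add: kl power2_eq_square mult_ac)
qed

section \<open>Mean values over short intervals\<close>

lemma sum_shift_int:
  fixes g :: "int \<Rightarrow> real"
  shows "(\<Sum>t\<in>{c..<c + n}. g t) = (\<Sum>x\<in>{0..<n}. g (x + c))"
  by (rule sum.reindex_bij_witness[of _ "\<lambda>x. x + c" "\<lambda>t. t - c"]) auto

lemma sum_periods:
  fixes g :: "int \<Rightarrow> real"
  assumes "Q > 0" "periodic g Q"
  shows "(\<Sum>t\<in>{c..<c + int k * Q}. g t) = real k * (\<Sum>x\<in>{0..<Q}. g x)"
proof (induction k)
  case (Suc k)
  have "{c..<c + int (Suc k) * Q} = {c..<c + int k * Q} \<union> {c + int k * Q..<(c + int k * Q) + Q}"
    using assms(1) by (auto simp: algebra_simps) (smt (verit) mult_nonneg_nonneg of_nat_0_le_iff)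
  moreover have "{c..<c + int k * Q} \<inter> {c + int k * Q..<(c + int k * Q) + Q} = {}" by auto
  moreover have "(\<Sum>t\<in>{c + int k * Q..<(c + int k * Q) + Q}. g t) = (\<Sum>x\<in>{0..<Q}. g x)"
    unfolding sum_shift_int by (rule sum_periodic_shift[OF assms])
  ultimately show ?case using Suc by (simp add: sum.union_disjoint algebra_simps)
qed simp

lemma sum_interval_periodic_le:
  fixes g :: "int \<Rightarrow> real"
  assumes Q: "Q > 0" and per: "periodic g Q" and nonneg: "\<And>x. g x \<ge> 0"
  shows "(\<Sum>t\<in>{c..<c + int n}. g t) \<le> (real n / Q + 1) * (\<Sum>x\<in>{0..<Q}. g x)"
proof -
  \<comment> \<open>The number of complete periods that suffices to cover \<open>n\<close>
    consecutive integers; covering more than the interval is harmless since \<open>g\<close> is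
    nonnegative.\<close>
  define k where "k = nat (int n div Q + 1)"
  have k: "int k = int n div Q + 1" using Q by (simp add: k_def pos_imp_zdiv_nonneg_iff)
  have "Q * (int n div Q) + int n mod Q = int n" by simp
  moreover have "int n mod Q < Q" using Q by simp
  moreover have "int k * Q = Q * (int n div Q) + Q" by (simp add: k algebra_simps)
  ultimately have "int n \<le> int k * Q" by linarith
  then have "(\<Sum>t\<in>{c..<c + int n}. g t) \<le> (\<Sum>t\<in>{c..<c + int k * Q}. g t)"
    using nonneg by (intro sum_mono2) auto
  also have "\<dots> = real k * (\<Sum>x\<in>{0..<Q}. g x)" by (rule sum_periods[OF Q per])
  also have "\<dots> \<le> (real n / Q + 1) * (\<Sum>x\<in>{0..<Q}. g x)"
  proof (intro mult_right_mono sum_nonneg nonneg)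
    have "real_of_int (int n div Q) \<le> real_of_int (int n) / real_of_int Q"
      by (rule real_of_int_div4) 
    then show "real k \<le> real n / Q + 1" using k by (metis add_le_cancel_right of_int_1 of_int_add of_int_of_nat_eq)
  qed
  finally show ?thesis .
qed

text \<open>The interval of \<open>w\<close> is folded modulo \<open>Q\<close> into a counting
  function \<open>f\<close>. Its total is \<open>k\<close> and its values are at most
  \<open>k / Q + 1\<close>, which bounds its l2 norm; the interval of \<open>t\<close> is covered by
  at most \<open>n / Q + 1\<close> periods. Cauchy-Schwarz in \<open>t\<close> then applies the
  kernel bound, whether or not the intervals are shorter than \<open>Q\<close>.\<close>

lemma kernel_norm_interval:
  assumes "kernel_norm \<psi> Q C"
  shows "\<bar>\<Sum>t\<in>{c..<c + int n}. \<Sum>w\<in>{d..<d + int k}. \<psi> (t + w)\<bar>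
    \<le> sqrt (real n * real k * C * (real n / Q + 1) * (real k / Q + 1))"
proof -
  have Q: "Q > 0" and C0: "C \<ge> 0" and per: "periodic \<psi> Q"
    and C: "\<And>f. (\<Sum>a\<in>{0..<Q}. (\<Sum>b\<in>{0..<Q}. f b * \<psi> (a + b))\<^sup>2) \<le> C * (\<Sum>b\<in>{0..<Q}. (f b)\<^sup>2)"
    using assms by (auto simp: kernel_norm_def)
  define B where "B = {d..<d + int k}"
  define f where "f = (\<lambda>b. \<Sum>w\<in>B. if w mod Q = b then 1 else (0::real))"
  have f0: "f b \<ge> 0" for b by (auto simp: f_def intro: sum_nonneg)
  have f1: "f b \<le> real k / Q + 1" if "b \<in> {0..<Q}" for b
  proof -
    have "periodic (\<lambda>w. if w mod Q = b then 1 else (0::real)) Q" by (simp add: periodic_def)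
    then have "f b \<le> (real k / Q + 1) * (\<Sum>w\<in>{0..<Q}. if w mod Q = b then 1 else (0::real))"
      unfolding f_def B_def by (intro sum_interval_periodic_le Q) auto
    also have "(\<Sum>w\<in>{0..<Q}. if w mod Q = b then 1 else (0::real)) = (\<Sum>w\<in>{0..<Q}. if w = b then 1 else 0)"
      by (intro sum.cong) auto
    also have "\<dots> = 1" using that by simp
    finally show ?thesis by simp
  qed
  have fsum: "(\<Sum>b\<in>{0..<Q}. f b) = real k"
  proof -
    have "(\<Sum>b\<in>{0..<Q}. f b) = (\<Sum>w\<in>B. \<Sum>b\<in>{0..<Q}. if w mod Q = b then 1 else 0)"
      unfolding f_def by (rule sum.swap)
    also have "\<dots> = (\<Sum>w\<in>B. 1)" using Q by (intro sum.cong refl) simp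
    finally show ?thesis by (simp add: B_def)
  qed
  have fsq: "(\<Sum>b\<in>{0..<Q}. (f b)\<^sup>2) \<le> (real k / Q + 1) * real k"
  proof -
    have "(\<Sum>b\<in>{0..<Q}. (f b)\<^sup>2) \<le> (\<Sum>b\<in>{0..<Q}. (real k / Q + 1) * f b)"
      unfolding power2_eq_square by (intro sum_mono mult_right_mono f0 f1)
    then show ?thesis by (simp add: fsum flip: sum_distrib_left)
  qed
  define g where "g = (\<lambda>t. (\<Sum>w\<in>B. \<psi> (t + w))\<^sup>2)"
  have g: "g a = (\<Sum>b\<in>{0..<Q}. f b * \<psi> (a + b))\<^sup>2" for a
  proof -
    have "(\<Sum>b\<in>{0..<Q}. f b * \<psi> (a + b)) = (\<Sum>w\<in>B. \<Sum>b\<in>{0..<Q}. if w mod Q = b then \<psi> (a + b) else 0)"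
      unfolding f_def sum_distrib_right by (subst sum.swap) (intro sum.cong refl, simp)
    also have "\<dots> = (\<Sum>w\<in>B. \<psi> (a + w mod Q))" using Q by (intro sum.cong refl) simp
    also have "\<dots> = (\<Sum>w\<in>B. \<psi> (a + w))"
      by (intro sum.cong refl periodic_cong[OF per] cong_add) auto
    finally show ?thesis by (simp add: g_def)
  qed
  have "periodic g Q"
    unfolding g_def
    by (intro periodicI arg_cong[of _ _ "\<lambda>x. x\<^sup>2"] sum.cong refl periodic_cong[OF per] cong_add) auto
  then have "(\<Sum>t\<in>{c..<c + int n}. g t) \<le> (real n / Q + 1) * (\<Sum>a\<in>{0..<Q}. g a)"
    by (intro sum_interval_periodic_le Q) (auto simp: g_def)
  also have "\<dots> \<le> (real n / Q + 1) * (C * (\<Sum>b\<in>{0..<Q}. (f b)\<^sup>2))"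
    unfolding g using C Q by (intro mult_left_mono) auto
  also have "\<dots> \<le> (real n / Q + 1) * (C * ((real k / Q + 1) * real k))"
    using fsq C0 Q by (intro mult_left_mono) auto
  finally have gsum: "(\<Sum>t\<in>{c..<c + int n}. g t) \<le> (real n / Q + 1) * (C * ((real k / Q + 1) * real k))" .
  have "(\<Sum>t\<in>{c..<c + int n}. 1 * (\<Sum>w\<in>B. \<psi> (t + w)))\<^sup>2
    \<le> (\<Sum>t\<in>{c..<c + int n}. 1\<^sup>2) * (\<Sum>t\<in>{c..<c + int n}. (\<Sum>w\<in>B. \<psi> (t + w))\<^sup>2)"
    by (rule Cauchy_Schwarz_ineq_sum)
  also have "\<dots> = real n * (\<Sum>t\<in>{c..<c + int n}. g t)" by (simp add: g_def)
  also have "\<dots> \<le> real n * ((real n / Q + 1) * (C * ((real k / Q + 1) * real k)))"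
    using gsum by (intro mult_left_mono) auto
  finally have "(\<Sum>t\<in>{c..<c + int n}. \<Sum>w\<in>B. \<psi> (t + w))\<^sup>2
    \<le> real n * real k * C * (real n / Q + 1) * (real k / Q + 1)"
    by (simp add: mult_ac)
  then show ?thesis unfolding B_def by (metis real_sqrt_abs real_sqrt_le_mono)
qed

text \<open>
  The sharp cutoff is majorised by the convolution of two intervals of comparable length, which
  turns each correlation into a bilinear form of the kernel.
\<close>

lemma mean_square_Jacobi_sum:
  fixes P :: "nat set" and c :: int and H :: nat
  assumes P: "finite P" "\<And>m. m \<in> P \<Longrightarrow> odd m \<and> squarefree m" and H: "H > 0"
  shows "(\<Sum>n\<in>{c..<c + int H}. (\<Sum>m\<in>P. real_of_int (Jacobi n m))\<^sup>2)
    \<le> (\<Sum>m\<in>P. \<Sum>m'\<in>P. 2 * sqrt (real (m * m')) + 4 * real H * real (gcd m m') / sqrt (real (m * m')))"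
proof -
  define F where "F = (\<lambda>n. (\<Sum>m\<in>P. real_of_int (Jacobi n m))\<^sup>2)"
  \<comment> \<open>Twice the length of the original interval, so that for every shift
    \<open>w\<close> in \<open>B\<close> the translate of \<open>A\<close> by \<open>w\<close> still
    contains it.\<close>
  define A where "A = {c - int H..<c - int H + int (2 * H)}"
  define B where "B = {0..<0 + int H}"
  have F0: "F n \<ge> 0" for n by (simp add: F_def)
  have "(\<Sum>n\<in>{c..<c + int H}. F n) \<le> (\<Sum>t\<in>A. F (t + w))" if "w \<in> B" for w
  proof -
    have "(\<Sum>n\<in>{c..<c + int H}. F n) = (\<Sum>t\<in>{c - w..<c - w + int H}. F (t + w))"
      by (rule sum.reindex_bij_witness[of _ "\<lambda>t. t + w" "\<lambda>n. n - w"]) auto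
    also have "\<dots> \<le> (\<Sum>t\<in>A. F (t + w))"
      using that by (intro sum_mono2) (auto simp: A_def B_def F0)
    finally show ?thesis .
  qed
  then have "(\<Sum>w\<in>B. \<Sum>n\<in>{c..<c + int H}. F n) \<le> (\<Sum>w\<in>B. \<Sum>t\<in>A. F (t + w))"
    by (rule sum_mono)
  then have "real H * (\<Sum>n\<in>{c..<c + int H}. F n) \<le> (\<Sum>t\<in>A. \<Sum>w\<in>B. F (t + w))"
    by (simp add: B_def sum.swap[of _ _ A])
  also have "\<dots> = (\<Sum>m\<in>P. \<Sum>m'\<in>P. \<Sum>t\<in>A. \<Sum>w\<in>B. real_of_int (Jacobi (t + w) m * Jacobi (t + w) m'))"
  proof -
    have "(\<Sum>t\<in>A. \<Sum>w\<in>B. F (t + w))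
      = (\<Sum>t\<in>A. \<Sum>w\<in>B. \<Sum>m\<in>P. \<Sum>m'\<in>P. real_of_int (Jacobi (t + w) m * Jacobi (t + w) m'))"
      by (simp add: F_def power2_eq_square sum_product)
    then show ?thesis by (simp only: sum.swap[of _ P B] sum.swap[of _ P A])
  qed
  also have "\<dots> \<le> (\<Sum>m\<in>P. \<Sum>m'\<in>P. real H *
     (2 * sqrt (real (m * m')) + 4 * real H * real (gcd m m') / sqrt (real (m * m'))))"
  proof (intro sum_mono)
    fix m m' assume m: "m \<in> P" "m' \<in> P"
    define Q where "Q = real (lcm m m')"
    define s where "s = sqrt (real (m * m'))"
    have pos: "m > 0" "m' > 0" using P(2) m by (auto simp: odd_pos)
    then have "Q > 0" "s > 0" by (auto simp: Q_def s_def lcm_pos_nat)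
    have s2: "s * s = real (m * m')" by (simp add: s_def)
    have "real (gcd m m') * Q = s * s"
      unfolding s2 Q_def by (metis of_nat_mult prod_gcd_lcm_nat)
    then have gq: "s / Q = real (gcd m m') / s"
      using \<open>Q > 0\<close> \<open>s > 0\<close> by (simp add: field_simps)
    have "(\<Sum>t\<in>A. \<Sum>w\<in>B. real_of_int (Jacobi (t + w) m * Jacobi (t + w) m'))
       \<le> sqrt (real (2 * H) * real H * real (m * m') * (real (2 * H) / Q + 1) * (real H / Q + 1))"
      using kernel_norm_interval[OF kernel_norm_Jacobi_mult[of m m'],
          where c = "c - int H" and n = "2 * H" and d = 0 and k = H] P(2) m
      by (simp add: A_def B_def Q_def abs_le_iff)
    \<comment> \<open>Both lengths are raised to \<open>2 * H\<close>, which makes the radicand a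
      perfect square.\<close>
    also have "\<dots> \<le> sqrt ((2 * real H * s * (2 * real H / Q + 1))\<^sup>2)"
    proof (rule real_sqrt_le_mono)
      have "real (2 * H) * real H * real (m * m') * (real (2 * H) / Q + 1) * (real H / Q + 1)
         \<le> real (2 * H) * real (2 * H) * real (m * m') * (real (2 * H) / Q + 1) * (real (2 * H) / Q + 1)"
        using \<open>Q > 0\<close> by (intro mult_mono add_mono divide_right_mono) auto
      also have "\<dots> = (2 * real H * s * (2 * real H / Q + 1))\<^sup>2"
        unfolding s2[symmetric] by (simp add: power2_eq_square algebra_simps add_divide_distrib)
      finally show "real (2 * H) * real H * real (m * m') * (real (2 * H) / Q + 1) * (real H / Q + 1)
         \<le> (2 * real H * s * (2 * real H / Q + 1))\<^sup>2" .
    qed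
    also have "\<dots> = 2 * real H * s * (2 * real H / Q + 1)"
      using \<open>Q > 0\<close> \<open>s > 0\<close> by (intro real_sqrt_unique) (auto intro!: mult_nonneg_nonneg add_nonneg_nonneg)
    \<comment> \<open>After division by \<open>H\<close>, the term \<open>2 * s\<close> is the price
      of an incomplete period. The other term counts complete periods of length \<open>Q\<close>; it
      becomes \<open>4 * H\<close> on the diagonal and decays with the gcd elsewhere.\<close>
    also have "\<dots> = real H * (2 * s + 4 * real H * (s / Q))"
      by (simp add: algebra_simps)
    finally show "(\<Sum>t\<in>A. \<Sum>w\<in>B. real_of_int (Jacobi (t + w) m * Jacobi (t + w) m'))
      \<le> real H * (2 * sqrt (real (m * m')) + 4 * real H * real (gcd m m') / sqrt (real (m * m')))"
      unfolding gq by (simp add: s_def)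
  qed
  finally show ?thesis using H by (simp add: F_def flip: sum_distrib_left)
qed

section \<open>Sums of greatest common divisors and multiplicative energy\<close>

text \<open>Writing \<open>a = d * e\<close> embeds the pairs (a, divisor of a) into the square of
  pairs with \<open>d, e \<le> v\<close>, where the sum factors.\<close>

lemma sum_divisor_count_le:
  "(\<Sum>a\<in>{1..v}. real (card {d. d dvd a}) / real a) \<le> (harm v)\<^sup>2"
proof -
  have "(\<Sum>a\<in>{1..v}. real (card {d. d dvd a}) / real a) = (\<Sum>a\<in>{1..v}. \<Sum>d\<in>{d. d dvd a}. 1 / real a)"
    by simp
  also have "\<dots> = (\<Sum>(a, d)\<in>Sigma {1..v} (\<lambda>a. {d. d dvd a}). 1 / real a)"
    by (intro sum.Sigma) auto
  also have "\<dots> \<le> (\<Sum>(d, e)\<in>{1..v} \<times> {1..v}. inverse (real d) * inverse (real e))"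
  proof (rule sum_le_included[of _ _ _ "\<lambda>(d, e). (d * e, d)"])
    show "\<forall>x\<in>Sigma {1..v} (\<lambda>a. {d. d dvd a}). \<exists>y\<in>{1..v} \<times> {1..v}.
      (case y of (d, e) \<Rightarrow> (d * e, d)) = x \<and>
      (case x of (a, d) \<Rightarrow> 1 / real a) \<le> (case y of (d, e) \<Rightarrow> inverse (real d) * inverse (real e))"
    proof safe
      fix a d assume a: "a \<in> {1..v}" "d dvd a"
      then obtain e where e: "a = d * e" by auto
      with a have "d > 0" "e > 0" by (auto intro!: Nat.gr0I)
      moreover have "d \<le> v" "e \<le> v" using a e \<open>d > 0\<close> \<open>e > 0\<close>
        by (auto intro: order.trans[of d "d * e"] order.trans[of e "d * e"])
      ultimately show "\<exists>y\<in>{1..v} \<times> {1..v}. (case y of (d, e) \<Rightarrow> (d * e, d)) = (a, d) \<and>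
        (1 / real a) \<le> (case y of (d, e) \<Rightarrow> inverse (real d) * inverse (real e))"
        using e by (intro bexI[of _ "(d, e)"]) (auto simp: divide_inverse)
    qed
  qed (auto simp: finite_divisors_nat)
  also have "\<dots> = (harm v)\<^sup>2"
    by (simp add: harm_def power2_eq_square sum_product sum.cartesian_product)
  finally show ?thesis .
qed

lemma real_div_minus_1_le: "real u / real k - 1 \<le> real (u div k)"
  by (metis diff_le_eq floor_divide_of_nat_eq less_imp_le of_int_of_nat_eq real_of_int_floor_add_one_gt)

lemma card_multiples_le:
  fixes u v \<beta> :: nat
  assumes "\<beta> > 0" "u \<le> v"
  shows "real (card {n \<in> {u<..v}. \<beta> dvd n}) \<le> real (v - u) / \<beta> + 1"
proof -
  have "{n \<in> {u<..v}. \<beta> dvd n} \<subseteq> (\<lambda>k. \<beta> * k) ` {u div \<beta><..v div \<beta>}"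
  proof
    fix n assume "n \<in> {n \<in> {u<..v}. \<beta> dvd n}"
    then obtain k where "n = \<beta> * k" "u < \<beta> * k" "\<beta> * k \<le> v" by auto
    moreover from this have "u div \<beta> < k" "k \<le> v div \<beta>"
      using assms by (auto simp: less_eq_div_iff_mult_less_eq div_less_iff_less_mult mult_ac)
    ultimately show "n \<in> (\<lambda>k. \<beta> * k) ` {u div \<beta><..v div \<beta>}" by auto
  qed
  then have "card {n \<in> {u<..v}. \<beta> dvd n} \<le> card {u div \<beta><..v div \<beta>}"
    by (meson card_image_le card_mono finite_greaterThanAtMost finite_imageI order.trans)
  then have "real (card {n \<in> {u<..v}. \<beta> dvd n}) \<le> real (v div \<beta>) - real (u div \<beta>)"
    using div_le_mono[OF assms(2), of \<beta>] by (simp add: of_nat_diff)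
  also have "\<dots> \<le> real v / \<beta> - (real u / \<beta> - 1)"
  proof (intro diff_mono)
    show "real (v div \<beta>) \<le> real v / real \<beta>" by (rule of_nat_div_le_of_nat)
    show "real u / \<beta> - 1 \<le> real (u div \<beta>)" by (rule real_div_minus_1_le)
  qed
  also have "\<dots> = real (v - u) / \<beta> + 1" using assms by (simp add: of_nat_diff diff_divide_distrib)
  finally show ?thesis .
qed

text \<open>The gcd is a divisor of \<open>a\<close> that divides \<open>a - b\<close>, so it is
  majorised by the sum of all such divisors. As \<open>b < a\<close>, the difference is positive,
  and a divisor \<open>d\<close> occurs at most \<open>(v - u) div d\<close> times without an extra
  1; hence each divisor contributes at most the length of the interval. This is why the diagonal is
  treated apart.\<close>

lemma sum_gcd_below_le:
  fixes u a :: nat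
  assumes "u < a" "a \<le> v"
  shows "(\<Sum>b\<in>{u<..<a}. real (gcd a b)) \<le> real (v - u) * real (card {d. d dvd a})"
proof -
  define D where "D = {d. d dvd a}"
  have D: "finite D" using assms by (simp add: D_def finite_divisors_nat)
  have "(\<Sum>b\<in>{u<..<a}. real (gcd a b)) \<le> (\<Sum>b\<in>{u<..<a}. \<Sum>d\<in>D. if d dvd a - b then real d else 0)"
  proof (intro sum_mono)
    fix b assume "b \<in> {u<..<a}"
    then have "real (gcd a b) = (if gcd a b dvd a - b then real (gcd a b) else 0)"
      by (simp add: dvd_diff_nat)
    also have "\<dots> \<le> (\<Sum>d\<in>D. if d dvd a - b then real d else 0)"
      by (rule member_le_sum[OF _ _ D]) (auto simp: D_def)
    finally show "real (gcd a b) \<le> (\<Sum>d\<in>D. if d dvd a - b then real d else 0)" .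
  qed
  also have "\<dots> = (\<Sum>d\<in>D. \<Sum>b\<in>{u<..<a}. if d dvd a - b then real d else 0)"
    by (rule sum.swap)
  also have "\<dots> \<le> (\<Sum>d\<in>D. real (v - u))"
  proof (intro sum_mono)
    fix d assume "d \<in> D"
    then have "d > 0" using assms by (auto simp: D_def intro!: Nat.gr0I)
    have "(\<Sum>b\<in>{u<..<a}. if d dvd a - b then real d else 0) = real d * real (card {b \<in> {u<..<a}. d dvd a - b})"
      by (simp add: sum.If_cases Int_def)
    also have "card {b \<in> {u<..<a}. d dvd a - b} \<le> card {1..(v - u) div d}"
    proof (rule card_inj_on_le[of "\<lambda>b. (a - b) div d"])
      show "inj_on (\<lambda>b. (a - b) div d) {b \<in> {u<..<a}. d dvd a - b}"
      proof (rule inj_onI)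
        fix b b' assume *: "b \<in> {b \<in> {u<..<a}. d dvd a - b}" "b' \<in> {b \<in> {u<..<a}. d dvd a - b}"
          "(a - b) div d = (a - b') div d"
        then have "a - b = a - b'" by (metis (mono_tags, lifting) dvd_div_mult_self mem_Collect_eq)
        with * show "b = b'" by auto
      qed
      show "(\<lambda>b. (a - b) div d) ` {b \<in> {u<..<a}. d dvd a - b} \<subseteq> {1..(v - u) div d}"
        using assms \<open>d > 0\<close> by (auto intro!: div_le_mono simp: Suc_le_eq div_greater_zero_iff dvd_imp_le)
    qed simp
    then have "real d * real (card {b \<in> {u<..<a}. d dvd a - b}) \<le> real d * real ((v - u) div d)"
      by (intro mult_left_mono) auto
    also have "\<dots> \<le> real (v - u)"
      by (metis of_nat_le_iff of_nat_mult times_div_less_eq_dividend)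
    finally show "(\<Sum>b\<in>{u<..<a}. if d dvd a - b then real d else 0) \<le> real (v - u)" .
  qed
  finally show ?thesis by (simp add: D_def mult.commute)
qed

text \<open>The diagonal contributes the length once and the two symmetric halves twice, which gives
  the 3. With the maximum as denominator, each half is a sum over \<open>b\<close> below a fixed
  denominator \<open>a\<close>.\<close>

lemma sum_gcd_max_le:
  fixes u v :: nat
  assumes "u < v"
  shows "(\<Sum>a\<in>{u<..v}. \<Sum>b\<in>{u<..v}. real (gcd a b) / real (max a b)) \<le> 3 * real (v - u) * (harm v)\<^sup>2"
proof -
  define S where "S = {u<..v}"
  define q where "q = (\<lambda>a b. real (gcd a b) / real (max a b))"
  define r where "r = (\<lambda>a b. if b < a then real (gcd a b) / real a else 0)"
  have "(\<Sum>a\<in>S. \<Sum>b\<in>S. q a b) = (\<Sum>a\<in>S. \<Sum>b\<in>S. (if a = b then 1 else 0) + r a b + r b a)"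
    by (intro sum.cong refl) (auto simp: q_def r_def S_def gcd.commute max_def)
  also have "\<dots> = real (card S) + (\<Sum>a\<in>S. \<Sum>b\<in>S. r a b) + (\<Sum>a\<in>S. \<Sum>b\<in>S. r b a)"
    by (simp add: sum.distrib S_def)
  also have "(\<Sum>a\<in>S. \<Sum>b\<in>S. r b a) = (\<Sum>a\<in>S. \<Sum>b\<in>S. r a b)" by (rule sum.swap)
  finally have eq: "(\<Sum>a\<in>S. \<Sum>b\<in>S. q a b) = real (v - u) + 2 * (\<Sum>a\<in>S. \<Sum>b\<in>S. r a b)"
    by (simp add: S_def)
  have "(\<Sum>b\<in>S. r a b) \<le> real (v - u) * (real (card {d. d dvd a}) / real a)" if "a \<in> S" for a
  proof -
    have "(\<Sum>b\<in>S. r a b) = (\<Sum>b\<in>{u<..<a}. real (gcd a b)) / real a"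
      unfolding sum_divide_distrib using that
      by (intro sum.mono_neutral_cong_right) (auto simp: r_def S_def)
    also have "\<dots> \<le> real (v - u) * real (card {d. d dvd a}) / real a"
      using that by (intro divide_right_mono sum_gcd_below_le) (auto simp: S_def)
    finally show ?thesis by simp
  qed
  then have "(\<Sum>a\<in>S. \<Sum>b\<in>S. r a b) \<le> (\<Sum>a\<in>S. real (v - u) * (real (card {d. d dvd a}) / real a))"
    by (rule sum_mono)
  also have "\<dots> = real (v - u) * (\<Sum>a\<in>S. real (card {d. d dvd a}) / real a)"
    by (simp add: sum_distrib_left)
  also have "\<dots> \<le> real (v - u) * (\<Sum>a\<in>{1..v}. real (card {d. d dvd a}) / real a)"
    by (intro mult_left_mono sum_mono2) (auto simp: S_def)
  also have "\<dots> \<le> real (v - u) * (harm v)\<^sup>2"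
    by (intro mult_left_mono sum_divisor_count_le) auto
  finally have "(\<Sum>a\<in>S. \<Sum>b\<in>S. q a b) \<le> real (v - u) * 1 + 2 * (real (v - u) * (harm v)\<^sup>2)"
    using eq by simp
  also have "real (v - u) * 1 \<le> real (v - u) * (harm v)\<^sup>2"
  proof (intro mult_left_mono)
    have "harm 1 \<le> (harm v :: real)" using assms by (intro harm_mono) auto
    then show "1 \<le> (harm v :: real)\<^sup>2" by (simp add: harm_expand one_le_power)
  qed auto
  finally show ?thesis by (simp add: S_def q_def)
qed

text \<open>Dividing \<open>a * b = c * d\<close> by the gcd of \<open>a\<close> and
  \<open>c\<close> gives \<open>\<alpha> * b = \<beta> * d\<close> with coprime coefficients:
  \<open>b\<close> is a multiple of \<open>\<beta>\<close> and determines \<open>d\<close>. So the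
  count is at most the length over \<open>\<beta>\<close>, plus 1, where 1 / \<open>\<beta>\<close>
  is the gcd over \<open>c\<close>. Exchanging the two sides of the equation allows the larger of
  \<open>a\<close> and \<open>c\<close> as denominator. The 4 is 3 from the gcd sum and 1 from the
  extra ones.\<close>

lemma multiplicative_energy_le:
  fixes u v :: nat
  assumes "u < v"
  shows "(\<Sum>a\<in>{u<..v}. \<Sum>c\<in>{u<..v}. \<Sum>b\<in>{u<..v}. \<Sum>d\<in>{u<..v}. if a * b = c * d then 1 else 0)
    \<le> 4 * (real (v - u))\<^sup>2 * (harm v)\<^sup>2"
proof -
  define S where "S = {u<..v}"
  have count: "(\<Sum>b\<in>S. \<Sum>d\<in>S. if a * b = c * d then 1 else 0) \<le> real (v - u) * (real (gcd a c) / real c) + 1"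
    if "a > 0" "c > 0" for a c
  proof -
    define g where "g = gcd a c"
    have "g > 0" using that by (simp add: g_def)
    then obtain \<alpha> \<beta> where ab: "a = g * \<alpha>" "c = g * \<beta>" and "coprime \<alpha> \<beta>"
      using gcd_coprime_exists[of a c] unfolding g_def by (metis mult.commute neq0_conv)
    have pos: "g > 0" "\<alpha> > 0" "\<beta> > 0" using that ab by (auto intro!: Nat.gr0I)
    have "(\<Sum>d\<in>S. if a * b = c * d then 1 else 0) \<le> (if \<beta> dvd b then 1 else (0::real))" for b
    proof (cases "\<exists>d\<in>S. a * b = c * d")
      case True
      then obtain d where d: "d \<in> S" "a * b = c * d" by blast
      then have "\<alpha> * b = \<beta> * d" using pos by (simp add: ab mult.assoc)
      then have "\<beta> dvd b"
        using \<open>coprime \<alpha> \<beta>\<close> by (metis coprime_commute coprime_dvd_mult_right_iff dvd_triv_left)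
      moreover have "(\<Sum>d'\<in>S. if a * b = c * d' then 1 else (0::real)) = (\<Sum>d'\<in>S. if d' = d then 1 else 0)"
        using d that by (intro sum.cong) auto
      ultimately show ?thesis using d by (simp add: S_def)
    qed (auto simp: sum_nonneg)
    then have "(\<Sum>b\<in>S. \<Sum>d\<in>S. if a * b = c * d then 1 else 0) \<le> (\<Sum>b\<in>S. if \<beta> dvd b then 1 else (0::real))"
      by (rule sum_mono)
    also have "\<dots> = real (card {b \<in> S. \<beta> dvd b})"
      by (simp add: sum.If_cases S_def Int_def)
    also have "\<dots> \<le> real (v - u) / \<beta> + 1"
      unfolding S_def using pos assms by (intro card_multiples_le) auto
    also have "real (v - u) / \<beta> = real (v - u) * (real g / real c)"
      using pos by (simp add: ab)
    finally show ?thesis by (simp add: g_def)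
  qed
  have "(\<Sum>b\<in>S. \<Sum>d\<in>S. if a * b = c * d then 1 else 0) \<le> real (v - u) * (real (gcd a c) / real (max a c)) + 1"
    if "a \<in> S" "c \<in> S" for a c
  proof (cases "a \<le> c")
    case True
    then show ?thesis using count[of a c] that by (simp add: S_def max_def)
  next
    case False
    have "(\<Sum>b\<in>S. \<Sum>d\<in>S. if a * b = c * d then 1 else (0::real)) = (\<Sum>d\<in>S. \<Sum>b\<in>S. if c * d = a * b then 1 else 0)"
      by (subst sum.swap) (simp add: eq_commute)
    then show ?thesis using count[of c a] that False by (simp add: S_def max_def gcd.commute)
  qed
  then have "(\<Sum>a\<in>S. \<Sum>c\<in>S. \<Sum>b\<in>S. \<Sum>d\<in>S. if a * b = c * d then 1 else 0)
    \<le> (\<Sum>a\<in>S. \<Sum>c\<in>S. real (v - u) * (real (gcd a c) / real (max a c)) + 1)"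
    by (intro sum_mono)
  also have "\<dots> = real (v - u) * (\<Sum>a\<in>S. \<Sum>c\<in>S. real (gcd a c) / real (max a c)) + (real (v - u))\<^sup>2"
  proof -
    define L q where "L = real (v - u)" and "q = (\<lambda>a c. real (gcd a c) / real (max a c))"
    have "real (card S) = L" by (simp add: S_def L_def)
    then have "(\<Sum>a\<in>S. \<Sum>c\<in>S. L * q a c + 1) = L * (\<Sum>a\<in>S. \<Sum>c\<in>S. q a c) + L\<^sup>2"
      by (simp add: sum.distrib power2_eq_square sum_distrib_left)
    then show ?thesis by (simp add: L_def q_def)
  qed
  also have "\<dots> \<le> real (v - u) * (3 * real (v - u) * (harm v)\<^sup>2) + (real (v - u))\<^sup>2 * (harm v)\<^sup>2"
  proof (intro add_mono mult_left_mono)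
    show "(\<Sum>a\<in>S. \<Sum>c\<in>S. real (gcd a c) / real (max a c)) \<le> 3 * real (v - u) * (harm v)\<^sup>2"
      unfolding S_def by (rule sum_gcd_max_le[OF assms])
    have "harm 1 \<le> (harm v :: real)" using assms by (intro harm_mono) auto
    then have "1 \<le> (harm v :: real)\<^sup>2" by (simp add: harm_expand one_le_power)
    then show "(real (v - u))\<^sup>2 \<le> (real (v - u))\<^sup>2 * (harm v)\<^sup>2"
      by (simp add: mult_le_cancel_left1)
  qed auto
  also have "\<dots> = 4 * (real (v - u))\<^sup>2 * (harm v)\<^sup>2" by (simp add: power2_eq_square algebra_simps)
  finally show ?thesis by (simp add: S_def)
qed

section \<open>The bilinear sum over a rectangle\<close>

text \<open>Cauchy-Schwarz after grouping by the value \<open>k\<close> of the product: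
  \<open>r k\<close> counts the representations of \<open>k\<close>, and the sum of its squares is
  the energy.\<close>

lemma sum_products_squared_le_energy:
  fixes g :: "nat \<Rightarrow> real"
  assumes S: "finite S" and I: "finite I" "\<And>a b. a \<in> S \<Longrightarrow> b \<in> S \<Longrightarrow> a * b \<in> I"
  shows "(\<Sum>a\<in>S. \<Sum>b\<in>S. g (a * b))\<^sup>2
    \<le> (\<Sum>a\<in>S. \<Sum>c\<in>S. \<Sum>b\<in>S. \<Sum>d\<in>S. if a * b = c * d then 1 else 0) * (\<Sum>k\<in>I. (g k)\<^sup>2)"
proof -
  define r where "r = (\<lambda>k. \<Sum>a\<in>S. \<Sum>b\<in>S. if a * b = k then 1 else (0::real))"
  have collect: "(\<Sum>k\<in>I. r k * f k) = (\<Sum>a\<in>S. \<Sum>b\<in>S. f (a * b))" for f :: "nat \<Rightarrow> real"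
  proof -
    have "(\<Sum>k\<in>I. r k * f k) = (\<Sum>k\<in>I. \<Sum>a\<in>S. \<Sum>b\<in>S. if a * b = k then f k else 0)"
      unfolding r_def sum_distrib_right by (intro sum.cong refl) simp
    also have "\<dots> = (\<Sum>a\<in>S. \<Sum>b\<in>S. \<Sum>k\<in>I. if a * b = k then f k else 0)"
      by (simp only: sum.swap[of _ S I])
    also have "\<dots> = (\<Sum>a\<in>S. \<Sum>b\<in>S. f (a * b))"
      using I by (intro sum.cong refl) simp
    finally show ?thesis .
  qed
  have "(\<Sum>k\<in>I. (r k)\<^sup>2) = (\<Sum>a\<in>S. \<Sum>b\<in>S. r (a * b))"
    unfolding power2_eq_square by (rule collect)
  also have "\<dots> = (\<Sum>a\<in>S. \<Sum>b\<in>S. \<Sum>c\<in>S. \<Sum>d\<in>S. if a * b = c * d then 1 else 0)"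
    unfolding r_def by (intro sum.cong refl) auto
  also have "\<dots> = (\<Sum>a\<in>S. \<Sum>c\<in>S. \<Sum>b\<in>S. \<Sum>d\<in>S. if a * b = c * d then 1 else 0)"
    by (rule sum.cong[OF refl]) (rule sum.swap)
  finally have "(\<Sum>k\<in>I. (r k)\<^sup>2) = (\<Sum>a\<in>S. \<Sum>c\<in>S. \<Sum>b\<in>S. \<Sum>d\<in>S. if a * b = c * d then 1 else 0)" .
  then show ?thesis using Cauchy_Schwarz_ineq_sum[of r g I] by (simp add: collect)
qed

definition odd_squarefree :: "nat set" where
  "odd_squarefree = {m. odd m \<and> squarefree m}"

text \<open>Complete multiplicativity in the upper entry merges the two symbols of the opened square
  into one at \<open>n * n'\<close>. Absolute values then remove the arbitrary coefficients
  \<open>a\<close>.\<close>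

lemma sum_norm_squared_le_correlations:
  fixes a :: "nat \<Rightarrow> complex"
  assumes S: "finite S" "\<And>n. n \<in> S \<Longrightarrow> norm (a n) \<le> 1"
    and P: "finite P" "P \<subseteq> odd_squarefree"
  shows "(\<Sum>m\<in>P. (norm (\<Sum>n\<in>S. a n * of_int (Jacobi (int n) m)))\<^sup>2)
    \<le> (\<Sum>n\<in>S. \<Sum>n'\<in>S. \<bar>\<Sum>m\<in>P. real_of_int (Jacobi (int (n * n')) m)\<bar>)"
proof -
  define A where "A = (\<lambda>m. \<Sum>n\<in>S. a n * of_int (Jacobi (int n) m))"
  have "complex_of_real (\<Sum>m\<in>P. (norm (A m))\<^sup>2) = (\<Sum>m\<in>P. A m * cnj (A m))"
    by (simp only: of_real_sum complex_norm_square)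
  also have "\<dots> = (\<Sum>m\<in>P. \<Sum>n\<in>S. \<Sum>n'\<in>S. a n * cnj (a n') * of_int (Jacobi (int (n * n')) m))"
    unfolding A_def cnj_sum sum_product
    using P by (intro sum.cong refl) (auto simp: Jacobi_mult_left odd_squarefree_def mult_ac)
  also have "\<dots> = (\<Sum>n\<in>S. \<Sum>n'\<in>S. \<Sum>m\<in>P. a n * cnj (a n') * of_int (Jacobi (int (n * n')) m))"
    by (simp only: sum.swap[of _ S P])
  also have "\<dots> = (\<Sum>n\<in>S. \<Sum>n'\<in>S. a n * cnj (a n') * of_real (\<Sum>m\<in>P. real_of_int (Jacobi (int (n * n')) m)))"
    by (simp add: sum_distrib_left)
  finally have eq: "complex_of_real (\<Sum>m\<in>P. (norm (A m))\<^sup>2)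
    = (\<Sum>n\<in>S. \<Sum>n'\<in>S. a n * cnj (a n') * of_real (\<Sum>m\<in>P. real_of_int (Jacobi (int (n * n')) m)))" .
  have "(\<Sum>m\<in>P. (norm (A m))\<^sup>2) = norm (complex_of_real (\<Sum>m\<in>P. (norm (A m))\<^sup>2))"
    by (simp only: norm_of_real) (simp add: sum_nonneg)
  also have "\<dots> \<le> (\<Sum>n\<in>S. \<Sum>n'\<in>S. norm (a n * cnj (a n') * of_real (\<Sum>m\<in>P. real_of_int (Jacobi (int (n * n')) m))))"
    unfolding eq by (intro order.trans[OF norm_sum] sum_mono order.refl)
  also have "\<dots> \<le> (\<Sum>n\<in>S. \<Sum>n'\<in>S. \<bar>\<Sum>m\<in>P. real_of_int (Jacobi (int (n * n')) m)\<bar>)"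
  proof (intro sum_mono)
    fix n n' assume "n \<in> S" "n' \<in> S"
    then have "norm (a n) * norm (a n') \<le> 1" using S(2) by (intro mult_le_one) auto
    then have "norm (a n) * norm (a n') * \<bar>\<Sum>m\<in>P. real_of_int (Jacobi (int (n * n')) m)\<bar>
       \<le> 1 * \<bar>\<Sum>m\<in>P. real_of_int (Jacobi (int (n * n')) m)\<bar>"
      by (intro mult_right_mono) auto
    then show "norm (a n * cnj (a n') * of_real (\<Sum>m\<in>P. real_of_int (Jacobi (int (n * n')) m)))
       \<le> \<bar>\<Sum>m\<in>P. real_of_int (Jacobi (int (n * n')) m)\<bar>"
      by (simp only: norm_mult norm_of_real complex_mod_cnj)
  qed
  finally show ?thesis by (simp add: A_def)
qed

text \<open>Since the sum over \<open>k\<close> has nonnegative terms, \<open>I\<close> may be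
  larger than the set of products; it will be an interval, where mean values of the symbols are
  available.\<close>

lemma bilinear_norm_power4_le:
  fixes a b :: "nat \<Rightarrow> complex"
  assumes S: "finite S" "\<And>n. n \<in> S \<Longrightarrow> norm (a n) \<le> 1"
    and P: "finite P" "P \<subseteq> odd_squarefree" "\<And>m. m \<in> P \<Longrightarrow> norm (b m) \<le> 1"
    and I: "finite I" "\<And>n n'. n \<in> S \<Longrightarrow> n' \<in> S \<Longrightarrow> n * n' \<in> I"
  shows "norm (\<Sum>m\<in>P. \<Sum>n\<in>S. a n * b m * of_int (Jacobi (int n) m)) ^ 4
    \<le> (real (card P))\<^sup>2 * ((\<Sum>a\<in>S. \<Sum>c\<in>S. \<Sum>b\<in>S. \<Sum>d\<in>S. if a * b = c * d then 1 else 0)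
        * (\<Sum>k\<in>I. (\<Sum>m\<in>P. real_of_int (Jacobi (int k) m))\<^sup>2))"
proof -
  define A where "A = (\<lambda>m. \<Sum>n\<in>S. a n * of_int (Jacobi (int n) m))"
  define Z where "Z = (\<Sum>m\<in>P. \<Sum>n\<in>S. a n * b m * of_int (Jacobi (int n) m))"
  define G where "G = (\<Sum>n\<in>S. \<Sum>n'\<in>S. \<bar>\<Sum>m\<in>P. real_of_int (Jacobi (int (n * n')) m)\<bar>)"
  have "Z = (\<Sum>m\<in>P. b m * A m)"
    unfolding Z_def A_def sum_distrib_left by (simp add: mult_ac)
  then have "norm Z \<le> (\<Sum>m\<in>P. norm (b m * A m))" by (simp add: norm_sum)
  also have "\<dots> \<le> (\<Sum>m\<in>P. 1 * norm (A m))"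
    unfolding norm_mult using P(3) by (intro sum_mono mult_right_mono) auto
  finally have "(norm Z)\<^sup>2 \<le> (\<Sum>m\<in>P. 1 * norm (A m))\<^sup>2" by (intro power_mono) auto
  also have "\<dots> \<le> (\<Sum>m\<in>P. 1\<^sup>2) * (\<Sum>m\<in>P. (norm (A m))\<^sup>2)" by (rule Cauchy_Schwarz_ineq_sum)
  also have "\<dots> \<le> real (card P) * G"
    unfolding G_def A_def using sum_norm_squared_le_correlations[OF S P(1,2)]
    by (simp add: mult_left_mono)
  finally have "((norm Z)\<^sup>2)\<^sup>2 \<le> (real (card P) * G)\<^sup>2" by (intro power_mono) auto
  also have "\<dots> = (real (card P))\<^sup>2 * G\<^sup>2" by (simp add: power_mult_distrib)
  also have "\<dots> \<le> (real (card P))\<^sup>2 * ((\<Sum>a\<in>S. \<Sum>c\<in>S. \<Sum>b\<in>S. \<Sum>d\<in>S. if a * b = c * d then 1 else 0)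
        * (\<Sum>k\<in>I. \<bar>\<Sum>m\<in>P. real_of_int (Jacobi (int k) m)\<bar>\<^sup>2))"
    unfolding G_def by (intro mult_left_mono sum_products_squared_le_energy S I) auto
  finally show ?thesis by (simp add: Z_def power2_eq_square eval_nat_numeral mult_ac)
qed

lemma sum_nat_interval_eq_int:
  fixes g :: "int \<Rightarrow> real"
  assumes "p \<le> q"
  shows "(\<Sum>k\<in>{p<..q}. g (int k)) = (\<Sum>n\<in>{int p + 1..<int p + 1 + int (q - p)}. g n)"
  by (rule sum.reindex_bij_witness[of _ nat int]) (use assms in auto)

text \<open>The hypothesis on \<open>x * (y - x)\<close> makes the square root terms no larger than
  the diagonal: they total 4 x K^2, with K = y - x, hence at most 4 V L K. The gcd terms give 8 * 2
  * 3 = 48, since the interval of squares has length at most \<open>2 * V * L\<close>; together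
  52.\<close>

lemma block_mean_square_le:
  fixes u v x y :: nat and V L l :: real
  assumes uv: "u < v" "real v \<le> V" "real (v - u) \<le> L"
    and xy: "x < y" "y \<le> 2 * x" "real x * real (y - x) \<le> V * L"
    and l: "harm y \<le> l"
  shows "(\<Sum>k\<in>{u\<^sup>2<..v\<^sup>2}. (\<Sum>m\<in>{x<..y} \<inter> odd_squarefree. real_of_int (Jacobi (int k) m))\<^sup>2)
    \<le> 52 * V * L * real (y - x) * l\<^sup>2"
proof -
  define P where "P = {x<..y} \<inter> odd_squarefree"
  define K where "K = real (y - x)"
  define H where "H = v\<^sup>2 - u\<^sup>2"
  have l1: "1 \<le> l\<^sup>2"
  proof -
    have "harm 1 \<le> (harm y :: real)" using xy by (intro harm_mono) auto
    then show ?thesis using l by (intro one_le_power) (simp add: harm_expand)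
  qed
  have hl: "(harm y)\<^sup>2 \<le> l\<^sup>2" using l by (intro power_mono) (auto simp: harm_nonneg)
  have VL: "V \<ge> 0" "L \<ge> 0" using uv by linarith+
  have K: "K \<ge> 0" by (simp add: K_def)
  have less: "u\<^sup>2 < v\<^sup>2" using uv by (simp add: power_strict_mono)
  then have "H > 0" by (simp add: H_def)
  have Hle: "real H \<le> 2 * V * L"
  proof -
    have "real H = real (v + u) * real (v - u)"
      using uv(1) less by (simp add: H_def of_nat_diff power2_eq_square algebra_simps)
    also have "\<dots> \<le> (2 * V) * L" using uv by (intro mult_mono) auto
    finally show ?thesis .
  qed
  have "(\<Sum>k\<in>{u\<^sup>2<..v\<^sup>2}. (\<Sum>m\<in>P. real_of_int (Jacobi (int k) m))\<^sup>2)
    = (\<Sum>n\<in>{int (u\<^sup>2) + 1..<int (u\<^sup>2) + 1 + int H}. (\<Sum>m\<in>P. real_of_int (Jacobi n m))\<^sup>2)"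
    unfolding H_def by (rule sum_nat_interval_eq_int[OF less_imp_le[OF less]])
  also have "\<dots> \<le> (\<Sum>m\<in>P. \<Sum>m'\<in>P. 2 * sqrt (real (m * m')) + 4 * real H * real (gcd m m') / sqrt (real (m * m')))"
    using \<open>H > 0\<close> by (intro mean_square_Jacobi_sum) (auto simp: P_def odd_squarefree_def)
  \<comment> \<open>In a dyadic range the geometric mean of \<open>m\<close> and \<open>m'\<close>
    lies between \<open>x\<close> and \<open>2 * x\<close>, so it is at least half of their
    maximum.\<close>
  also have "\<dots> \<le> (\<Sum>m\<in>P. \<Sum>m'\<in>P. 4 * real x + 8 * real H * (real (gcd m m') / real (max m m')))"
  proof (intro sum_mono add_mono)
    fix m m' assume "m \<in> P" "m' \<in> P"
    then have m: "x < m" "m \<le> 2 * x" "x < m'" "m' \<le> 2 * x" using xy by (auto simp: P_def)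
    have "real m * real m' \<le> (2 * real x) * (2 * real x)"
      using m by (intro mult_mono) auto
    then have "sqrt (real (m * m')) \<le> 2 * real x"
      by (intro real_le_lsqrt) (auto simp: power2_eq_square)
    then show "2 * sqrt (real (m * m')) \<le> 4 * real x" by simp
    have max: "real (max m m') \<le> 2 * real x" "real (max m m') > 0" using m by auto
    have "real x * real x \<le> real m * real m'"
      using m by (intro mult_mono) auto
    then have "sqrt ((real x)\<^sup>2) \<le> sqrt (real (m * m'))"
      by (intro real_sqrt_le_mono) (simp add: power2_eq_square)
    then have "real (max m m') / 2 \<le> sqrt (real (m * m'))" using max by simp
    then have "4 * real H * real (gcd m m') / sqrt (real (m * m')) \<le> 4 * real H * real (gcd m m') / (real (max m m') / 2)"
      using max m by (intro divide_left_mono mult_pos_pos) auto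
    then show "4 * real H * real (gcd m m') / sqrt (real (m * m')) \<le> 8 * real H * (real (gcd m m') / real (max m m'))"
      by simp
  qed
  also have "\<dots> \<le> (\<Sum>m\<in>{x<..y}. \<Sum>m'\<in>{x<..y}. 4 * real x + 8 * real H * (real (gcd m m') / real (max m m')))"
  proof -
    have "(\<Sum>m\<in>P. \<Sum>m'\<in>P. 4 * real x + 8 * real H * (real (gcd m m') / real (max m m')))
      \<le> (\<Sum>m\<in>P. \<Sum>m'\<in>{x<..y}. 4 * real x + 8 * real H * (real (gcd m m') / real (max m m')))"
      by (intro sum_mono sum_mono2) (auto simp: P_def)
    also have "\<dots> \<le> (\<Sum>m\<in>{x<..y}. \<Sum>m'\<in>{x<..y}. 4 * real x + 8 * real H * (real (gcd m m') / real (max m m')))"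
      by (intro sum_mono2 sum_nonneg) (auto simp: P_def)
    finally show ?thesis .
  qed
  also have "\<dots> = 4 * (real x * K) * K + 8 * real H * (\<Sum>m\<in>{x<..y}. \<Sum>m'\<in>{x<..y}. real (gcd m m') / real (max m m'))"
    unfolding sum.distrib sum_distrib_left[symmetric] using xy(1) by (simp add: K_def of_nat_diff)
  also have "\<dots> \<le> 4 * (V * L) * K + 8 * (2 * V * L) * (3 * K * (harm y)\<^sup>2)"
  proof (rule add_mono)
    show "4 * (real x * K) * K \<le> 4 * (V * L) * K"
      using xy(3) K unfolding K_def by (intro mult_right_mono mult_left_mono) auto
    show "8 * real H * (\<Sum>m\<in>{x<..y}. \<Sum>m'\<in>{x<..y}. real (gcd m m') / real (max m m'))
      \<le> 8 * (2 * V * L) * (3 * K * (harm y)\<^sup>2)"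
    proof (rule mult_mono)
      show "8 * real H \<le> 8 * (2 * V * L)" using Hle by linarith
      show "(\<Sum>m\<in>{x<..y}. \<Sum>m'\<in>{x<..y}. real (gcd m m') / real (max m m')) \<le> 3 * K * (harm y)\<^sup>2"
        unfolding K_def by (rule sum_gcd_max_le[OF xy(1)])
    qed (use VL in \<open>auto intro!: sum_nonneg\<close>)
  qed
  also have "\<dots> \<le> 4 * (V * L) * K * l\<^sup>2 + 8 * (2 * V * L) * (3 * K * l\<^sup>2)"
  proof (intro add_mono)
    show "4 * (V * L) * K \<le> 4 * (V * L) * K * l\<^sup>2"
      using l1 VL K mult_left_mono[OF l1, of "4 * (V * L) * K"] by simp
  qed (use hl VL K in \<open>intro mult_left_mono, auto\<close>)
  also have "\<dots> = 52 * V * L * K * l\<^sup>2" by simp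
  finally show ?thesis by (simp add: P_def K_def)
qed

text \<open>Compared with the trivial bound (K L)^4, where K = y - x, the gain is the factor K L /
  V. The constant is 4 * 52, from the energy and the mean square. \<open>V\<close> and
  \<open>L\<close> are upper bounds, not the exact endpoint and length, so that the size condition
  can be met with some slack.\<close>

lemma rectangle_power4_le:
  fixes a b :: "nat \<Rightarrow> complex" and V L l :: real
  assumes a: "\<And>n. norm (a n) \<le> 1" and b: "\<And>m. norm (b m) \<le> 1"
    and uv: "real v \<le> V" "real (v - u) \<le> L"
    and xy: "x < y" "y \<le> 2 * x" "real x * real (y - x) \<le> V * L"
    and l: "harm v \<le> l" "harm y \<le> l"
  shows "norm (\<Sum>m\<in>{x<..y} \<inter> odd_squarefree. \<Sum>n\<in>{u<..v}. a n * b m * of_int (Jacobi (int n) m)) ^ 4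
    \<le> 208 * real (y - x) ^ 3 * L ^ 3 * V * l ^ 4"
proof (cases "u < v")
  case False
  have "0 \<le> V" "0 \<le> L" using uv by linarith+
  then show ?thesis using False by simp
next
  case True
  define P where "P = {x<..y} \<inter> odd_squarefree"
  define K where "K = real (y - x)"
  have VL: "V \<ge> 0" "L \<ge> 0" using uv by linarith+
  have "card P \<le> y - x" unfolding P_def by (metis Int_lower1 card_greaterThanAtMost card_mono finite_greaterThanAtMost)
  then have P: "real (card P) \<le> K" by (simp add: K_def)
  have hl: "(harm v)\<^sup>2 \<le> l\<^sup>2" using l by (intro power_mono) (auto simp: harm_nonneg)
  have "norm (\<Sum>m\<in>P. \<Sum>n\<in>{u<..v}. a n * b m * of_int (Jacobi (int n) m)) ^ 4
    \<le> (real (card P))\<^sup>2 * ((\<Sum>a\<in>{u<..v}. \<Sum>c\<in>{u<..v}. \<Sum>b\<in>{u<..v}. \<Sum>d\<in>{u<..v}. if a * b = c * d then 1 else 0)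
        * (\<Sum>k\<in>{u\<^sup>2<..v\<^sup>2}. (\<Sum>m\<in>P. real_of_int (Jacobi (int k) m))\<^sup>2))"
    by (rule bilinear_norm_power4_le)
       (use a b in \<open>auto simp: P_def power2_eq_square intro: mult_strict_mono' mult_mono\<close>)
  also have "\<dots> \<le> K\<^sup>2 * ((4 * L\<^sup>2 * l\<^sup>2) * (52 * V * L * K * l\<^sup>2))"
  proof (intro mult_mono power_mono P)
    have "(\<Sum>a\<in>{u<..v}. \<Sum>c\<in>{u<..v}. \<Sum>b\<in>{u<..v}. \<Sum>d\<in>{u<..v}. if a * b = c * d then 1 else 0)
      \<le> 4 * (real (v - u))\<^sup>2 * (harm v)\<^sup>2" by (rule multiplicative_energy_le[OF True])
    also have "\<dots> \<le> 4 * L\<^sup>2 * l\<^sup>2"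
    proof (rule mult_mono[OF _ hl])
      show "4 * (real (v - u))\<^sup>2 \<le> 4 * L\<^sup>2"
        using uv(2) by (intro mult_left_mono power_mono) auto
    qed auto
    finally show "(\<Sum>a\<in>{u<..v}. \<Sum>c\<in>{u<..v}. \<Sum>b\<in>{u<..v}. \<Sum>d\<in>{u<..v}. if a * b = c * d then 1 else 0) \<le> 4 * L\<^sup>2 * l\<^sup>2" .
    show "(\<Sum>k\<in>{u\<^sup>2<..v\<^sup>2}. (\<Sum>m\<in>P. real_of_int (Jacobi (int k) m))\<^sup>2) \<le> 52 * V * L * K * l\<^sup>2"
      unfolding P_def K_def using block_mean_square_le[OF True uv xy l(2)] .
  qed (use VL in \<open>auto intro!: sum_nonneg mult_nonneg_nonneg\<close>)
  also have "\<dots> = 208 * K ^ 3 * L ^ 3 * V * l ^ 4"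
    by (simp add: power2_eq_square eval_nat_numeral mult_ac)
  finally show ?thesis by (simp add: P_def K_def)
qed

section \<open>The region under the hyperbola\<close>

text \<open>Cutting the curved triangle over \<open>(x, y]\<close> at \<open>w\<close> leaves a
  rectangle under the hyperbola at \<open>w\<close> and two curved triangles of the same shape, over
  \<open>(x, w]\<close> and \<open>(w, y]\<close>.\<close>

lemma triangle_split:
  fixes f :: "nat \<Rightarrow> nat \<Rightarrow> complex" and X :: "nat set"
  assumes "x \<le> w" "w \<le> y"
  shows "(\<Sum>m\<in>{x<..y} \<inter> X. \<Sum>n\<in>{N div y<..N div m}. f n m)
    = (\<Sum>m\<in>{x<..w} \<inter> X. \<Sum>n\<in>{N div y<..N div w}. f n m)
      + (\<Sum>m\<in>{x<..w} \<inter> X. \<Sum>n\<in>{N div w<..N div m}. f n m)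
      + (\<Sum>m\<in>{w<..y} \<inter> X. \<Sum>n\<in>{N div y<..N div m}. f n m)"
proof -
  have "{x<..y} \<inter> X = ({x<..w} \<inter> X) \<union> ({w<..y} \<inter> X)" using assms by auto
  then have "(\<Sum>m\<in>{x<..y} \<inter> X. \<Sum>n\<in>{N div y<..N div m}. f n m)
    = (\<Sum>m\<in>{x<..w} \<inter> X. \<Sum>n\<in>{N div y<..N div m}. f n m)
      + (\<Sum>m\<in>{w<..y} \<inter> X. \<Sum>n\<in>{N div y<..N div m}. f n m)"
    by (simp only:, intro sum.union_disjoint) auto
  moreover have "(\<Sum>m\<in>{x<..w} \<inter> X. \<Sum>n\<in>{N div y<..N div m}. f n m)
    = (\<Sum>m\<in>{x<..w} \<inter> X. (\<Sum>n\<in>{N div y<..N div w}. f n m) + (\<Sum>n\<in>{N div w<..N div m}. f n m))"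
  proof (intro sum.cong refl)
    fix m assume m: "m \<in> {x<..w} \<inter> X"
    then have "N div w \<le> N div m" by (intro div_le_mono2) auto
    moreover have "N div y \<le> N div w" using assms m by (intro div_le_mono2) auto
    ultimately have "{N div y<..N div m} = {N div y<..N div w} \<union> {N div w<..N div m}" by auto
    then show "(\<Sum>n\<in>{N div y<..N div m}. f n m)
      = (\<Sum>n\<in>{N div y<..N div w}. f n m) + (\<Sum>n\<in>{N div w<..N div m}. f n m)"
      by (simp only:, intro sum.union_disjoint) auto
  qed
  ultimately show ?thesis by (simp add: sum.distrib)
qed

text \<open>
  The triangle is cut into \<open>2 ^ i\<close> rectangles at each scale \<open>2 ^ -i\<close>. The bound for one of them
  decays like \<open>2 ^ (-3 i / 2)\<close>, so that no logarithm is lost in the summation over the scales.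
\<close>

lemma triangle_norm_le:
  fixes a b :: "nat \<Rightarrow> complex" and M N x j :: nat and l \<mu> :: real
  assumes a: "\<And>n. norm (a n) \<le> 1" and b: "\<And>m. norm (b m) \<le> 1"
    and \<mu>: "\<mu> > 0" "\<mu> ^ 4 = real M" and MN: "M * M \<le> N" and l: "harm (2 * N) \<le> l"
    and x: "M \<le> x" "x + 2 ^ j \<le> 2 * M"
  shows "norm (\<Sum>m\<in>{x<..x + 2 ^ j} \<inter> odd_squarefree. \<Sum>n\<in>{N div (x + 2 ^ j)<..N div m}.
      a n * b m * of_int (Jacobi (int n) m)) \<le> 14 * real N * l / \<mu> ^ 7 * sqrt 8 ^ j"
  using x
proof (induction j arbitrary: x)
  case 0
  \<comment> \<open>At width 1 the only candidate is \<open>m = x + 1\<close>, for which the range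
    of \<open>n\<close> is empty.\<close>
  have "{x<..x + 2 ^ 0} \<inter> odd_squarefree \<subseteq> {Suc x}" by auto
  then have "(\<Sum>m\<in>{x<..x + 2 ^ 0} \<inter> odd_squarefree. \<Sum>n\<in>{N div (x + 2 ^ 0)<..N div m}.
      a n * b m * of_int (Jacobi (int n) m)) = 0"
    by (intro sum.neutral) auto
  moreover have "l \<ge> 0" using l harm_nonneg[of "2 * N", where 'a = real] by linarith
  ultimately show ?case using \<mu> by simp
next
  case (Suc j)
  define K :: nat where "K = 2 ^ j"
  define w where "w = x + K"
  define y where "y = x + 2 * K"
  define f where "f = (\<lambda>n m. a n * b m * of_int (Jacobi (int n) m))"
  \<comment> \<open>Half of the claimed constant: the rectangle costs \<open>D * sqrt 8 ^ j\<close>,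
    each of the two smaller triangles \<open>2 * D * sqrt 8 ^ j\<close>, and
    \<open>5 \<le> 2 * sqrt 8\<close> closes the induction. Here sqrt 8 = 2^(3/2) is the growth of
    K^(3/2) when \<open>K\<close> doubles.\<close>
  define D where "D = 7 * real N * l / \<mu> ^ 7"
  have x: "M \<le> x" "y \<le> 2 * M" using Suc.prems by (auto simp: y_def K_def)
  have M: "M > 0" using \<mu> by (auto intro!: Nat.gr0I)
  have K: "K \<ge> 1" by (simp add: K_def)
  have l0: "l \<ge> 0" using l harm_nonneg[of "2 * N", where 'a = real] by linarith
  have "M \<le> M * M" using M by simp
  with MN have "M \<le> N" by linarith
  have MN': "real M * real M \<le> real N" using MN by (simp flip: of_nat_mult)
  have rect: "norm (\<Sum>m\<in>{x<..w} \<inter> odd_squarefree. \<Sum>n\<in>{N div y<..N div w}. f n m) \<le> D * sqrt 8 ^ j"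
  proof -
    define V where "V = real N / real M"
    \<comment> \<open>The exact height is at most K N / M^2 plus 1 from rounding the quotients; the
      factor 2 absorbs the 1, because M^2 <= N.\<close>
    define L where "L = 2 * real K * real N / (real M)\<^sup>2"
    have "norm (\<Sum>m\<in>{x<..w} \<inter> odd_squarefree. \<Sum>n\<in>{N div y<..N div w}. f n m) ^ 4
      \<le> 208 * real (w - x) ^ 3 * L ^ 3 * V * l ^ 4"
      unfolding f_def
    proof (rule rectangle_power4_le[OF a b])
      have "real (N div w) \<le> real N / real w" by (rule of_nat_div_le_of_nat)
      also have "\<dots> \<le> V" unfolding V_def using x M by (intro divide_left_mono) (auto simp: w_def)
      finally show "real (N div w) \<le> V" .
      have "real (N div w - N div y) \<le> real N / real w - (real N / real y - 1)"
      proof -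
        have "N div y \<le> N div w" using x M by (intro div_le_mono2) (auto simp: w_def y_def)
        moreover have "real (N div w) \<le> real N / real w" by (rule of_nat_div_le_of_nat)
        moreover have "real N / real y - 1 \<le> real (N div y)"
          by (rule real_div_minus_1_le)
        ultimately show ?thesis by (simp add: of_nat_diff)
      qed
      also have "\<dots> = real N * real K / (real w * real y) + 1"
      proof -
        have "real w > 0" "real y > 0" using x M by (auto simp: w_def y_def)
        then have "real N / real w - (real N / real y - 1) = real N * (real y - real w) / (real w * real y) + 1"
          by (simp add: right_diff_distrib diff_divide_distrib)
        also have "real y - real w = real K" by (simp add: w_def y_def)
        finally show ?thesis .
      qed
      also have "real N * real K / (real w * real y) \<le> real N * real K / (real M)\<^sup>2"
        unfolding power2_eq_square using x M
        by (intro divide_left_mono mult_mono) (auto simp: w_def y_def)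
      also have "1 \<le> real N * real K / (real M)\<^sup>2"
      proof -
        have "real M * real M * 1 \<le> real N * real K" using MN' K by (intro mult_mono) auto
        then show ?thesis using M by (simp add: power2_eq_square)
      qed
      finally show "real (N div w - N div y) \<le> L" by (simp add: L_def)
      show "x < w" "w \<le> 2 * x" using x K by (auto simp: w_def y_def)
      have "real x * real (w - x) \<le> (2 * real M) * real K"
        using x by (intro mult_mono) (auto simp: w_def y_def)
      \<comment> \<open>Here \<open>n\<close> has to be the longer variable: the inequality amounts
        to M^4 <= N^2.\<close>
      also have "\<dots> \<le> V * L"
      proof -
        have "(real M * real M) * (real M * real M) \<le> real N * real N"
          using MN' by (intro mult_mono) auto
        then have "real K * ((real M * real M) * (real M * real M)) \<le> real K * (real N * real N)"
          by (rule mult_left_mono) simp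
        then show ?thesis using M by (simp add: V_def L_def field_simps power2_eq_square)
      qed
      finally show "real x * real (w - x) \<le> V * L" .
      have "harm (N div w) \<le> (harm (2 * N) :: real)"
        by (intro harm_mono order.trans[OF div_le_dividend]) simp
      then show "harm (N div w) \<le> l" using l by linarith
      have "harm w \<le> (harm (2 * N) :: real)"
        using x \<open>M \<le> N\<close> by (intro harm_mono) (auto simp: w_def y_def)
      then show "harm w \<le> l" using l by linarith
    qed
    also have "\<dots> = 1664 * (real K ^ 6 * real N ^ 4 * l ^ 4 / real M ^ 7)"
      using M by (simp add: V_def L_def w_def field_simps eval_nat_numeral)
    \<comment> \<open>1664 is 208 times the 2^3 coming from \<open>L ^ 3\<close>; it is rounded up
      to 7^4, so that the fourth root is exact.\<close>
    also have "\<dots> \<le> 2401 * (real K ^ 6 * real N ^ 4 * l ^ 4 / real M ^ 7)"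
      by (intro mult_right_mono) auto
    also have "\<dots> = (D * sqrt 8 ^ j) ^ 4"
    proof -
      have "(sqrt 8 ^ j) ^ 4 = (sqrt 8 ^ 4) ^ j" by (simp add: mult.commute flip: power_mult)
      also have "sqrt 8 ^ 4 = (2::real) ^ 6"
        using power_mult[of "sqrt 8" 2 2] by simp
      also have "((2::real) ^ 6) ^ j = real K ^ 6"
        unfolding K_def by (metis mult.commute of_nat_numeral of_nat_power power_mult)
      finally have "(sqrt 8 ^ j) ^ 4 = real K ^ 6" .
      moreover have "(\<mu> ^ 7) ^ 4 = real M ^ 7"
        by (simp add: \<mu>(2)[symmetric] flip: power_mult)
      ultimately show ?thesis by (simp add: D_def power_mult_distrib power_divide)
    qed
    finally show ?thesis
      by (rule power_le_imp_le_base[where n = 3, simplified]) (use \<mu> l0 in \<open>auto simp: D_def\<close>)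
  qed
  have "x + 2 ^ j \<le> 2 * M" "w + 2 ^ j \<le> 2 * M" "M \<le> w" using x by (auto simp: w_def y_def K_def)
  then have IH: "norm (\<Sum>m\<in>{x<..w} \<inter> odd_squarefree. \<Sum>n\<in>{N div w<..N div m}. f n m) \<le> 2 * D * sqrt 8 ^ j"
    "norm (\<Sum>m\<in>{w<..y} \<inter> odd_squarefree. \<Sum>n\<in>{N div y<..N div m}. f n m) \<le> 2 * D * sqrt 8 ^ j"
    using Suc.IH[of x] Suc.IH[of w] x
    by (simp_all add: f_def D_def w_def y_def K_def mult_2 add.assoc mult_ac)
  have "norm (\<Sum>m\<in>{x<..y} \<inter> odd_squarefree. \<Sum>n\<in>{N div y<..N div m}. f n m)
    \<le> D * sqrt 8 ^ j + 2 * D * sqrt 8 ^ j + 2 * D * sqrt 8 ^ j"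
    unfolding triangle_split[of x w y, OF le_add1[of x K, folded w_def]
        add_left_mono[of K "2 * K" x, folded w_def y_def, simplified]]
    using rect IH by (intro norm_triangle_le add_mono) auto
  also have "\<dots> = 5 * (D * sqrt 8 ^ j)" by simp
  also have "\<dots> \<le> (2 * sqrt 8) * (D * sqrt 8 ^ j)"
  proof (rule mult_right_mono)
    have "5 / 2 \<le> sqrt 8" by (rule real_le_rsqrt) (simp add: power2_eq_square)
    then show "5 \<le> 2 * sqrt 8" by simp
  qed (use \<mu> l0 in \<open>simp add: D_def\<close>)
  finally show ?case by (simp add: f_def D_def y_def K_def mult_ac)
qed

text \<open>Over \<open>(M, 2 M]\<close> the region is the rectangle below N / (2 M) with a curved
  triangle on top; their constants 4 (since 208 <= 4^4) and 14 add up to 18.\<close>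

lemma dyadic_block_norm_le:
  fixes a b :: "nat \<Rightarrow> complex" and N k :: nat and l :: real
  assumes a: "\<And>n. norm (a n) \<le> 1" and b: "\<And>m. norm (b m) \<le> 1"
    and MN: "2 ^ k * 2 ^ k \<le> N" and l: "harm (2 * N) \<le> l"
  shows "norm (\<Sum>m\<in>{2 ^ k<..2 ^ Suc k} \<inter> odd_squarefree. \<Sum>n\<in>{0<..N div m}.
      a n * b m * of_int (Jacobi (int n) m)) \<le> 18 * real N * l / (2 powr (1 / 4)) ^ k"
proof -
  define M :: nat where "M = 2 ^ k"
  define \<mu> :: real where "\<mu> = (2 powr (1 / 4)) ^ k"
  define f where "f = (\<lambda>n m. a n * b m * of_int (Jacobi (int n) m))"
  have \<mu>0: "\<mu> > 0" by (simp add: \<mu>_def)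
  have "((2::real) powr (1 / 4)) ^ 4 = 2" by (simp add: powr_power)
  then have \<mu>4: "\<mu> ^ 4 = real M"
    unfolding \<mu>_def M_def by (metis mult.commute of_nat_numeral of_nat_power power_mult)
  have MN': "M * M \<le> N" using MN by (simp add: M_def)
  have M: "M > 0" by (simp add: M_def)
  have "M \<le> M * M" using M by simp
  with MN' have "M \<le> N" by linarith
  have rMN: "real M * real M \<le> real N" using MN' by (simp flip: of_nat_mult)
  have l0: "l \<ge> 0" using l harm_nonneg[of "2 * N", where 'a = real] by linarith
  have tri: "norm (\<Sum>m\<in>{M<..2 * M} \<inter> odd_squarefree. \<Sum>n\<in>{N div (2 * M)<..N div m}. f n m) \<le> 14 * real N * l / \<mu>"
  proof -
    have "norm (\<Sum>m\<in>{M<..M + 2 ^ k} \<inter> odd_squarefree. \<Sum>n\<in>{N div (M + 2 ^ k)<..N div m}. f n m)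
      \<le> 14 * real N * l / \<mu> ^ 7 * sqrt 8 ^ k"
      unfolding f_def by (rule triangle_norm_le[OF a b \<mu>0 \<mu>4 MN' l]) (auto simp: M_def)
    \<comment> \<open>The triangle has width M, so sqrt 8 ^ k is M^(3/2); with \<open>\<mu>\<close>
      equal to M^(1/4) it reduces \<open>\<mu> ^ 7\<close> in the denominator to
      \<open>\<mu>\<close>.\<close>
    moreover have "sqrt 8 ^ k = \<mu> ^ 6"
    proof -
      have "((2::real) powr (1 / 4)) ^ 6 = 2 powr (3 / 2)" by (simp add: powr_power)
      also have "\<dots> = sqrt 8"
      proof -
        have "(2::real) powr (3 / 2) = (2 powr 3) powr (1 / 2)" by (simp only: powr_powr) simp
        also have "(2::real) powr 3 = 8" by simp
        finally show ?thesis by (simp add: powr_half_sqrt)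
      qed
      finally show ?thesis unfolding \<mu>_def by (metis mult.commute power_mult)
    qed
    moreover have "14 * real N * l / \<mu> ^ 7 * \<mu> ^ 6 = 14 * real N * l / \<mu>"
      using \<mu>0 by (simp add: field_simps eval_nat_numeral)
    ultimately show ?thesis by (simp add: M_def mult_2)
  qed
  have rect: "norm (\<Sum>m\<in>{M<..2 * M} \<inter> odd_squarefree. \<Sum>n\<in>{0<..N div (2 * M)}. f n m) \<le> 4 * real N * l / \<mu>"
  proof -
    define V where "V = real N / real M"
    have V: "real (N div (2 * M)) \<le> V"
    proof -
      have "real (N div (2 * M)) \<le> real N / real (2 * M)" by (rule of_nat_div_le_of_nat)
      also have "\<dots> \<le> V" unfolding V_def using M by (intro divide_left_mono) auto
      finally show ?thesis .
    qed
    have "norm (\<Sum>m\<in>{M<..2 * M} \<inter> odd_squarefree. \<Sum>n\<in>{0<..N div (2 * M)}. f n m) ^ 4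
      \<le> 208 * real (2 * M - M) ^ 3 * V ^ 3 * V * l ^ 4"
      unfolding f_def
    proof (rule rectangle_power4_le[OF a b V])
      show "real (N div (2 * M) - 0) \<le> V" using V by simp
      show "M < 2 * M" "2 * M \<le> 2 * M" using M by auto
      have "real M \<le> V" using rMN M by (simp add: V_def field_simps)
      then show "real M * real (2 * M - M) \<le> V * V" by (intro mult_mono) (auto simp: V_def)
      have "harm (N div (2 * M)) \<le> (harm (2 * N) :: real)"
        by (intro harm_mono order.trans[OF div_le_dividend]) simp
      then show "harm (N div (2 * M)) \<le> l" using l by linarith
      have "harm (2 * M) \<le> (harm (2 * N) :: real)" using \<open>M \<le> N\<close> by (intro harm_mono) auto
      then show "harm (2 * M) \<le> l" using l by linarith
    qed
    also have "\<dots> = 208 * (real N ^ 4 * l ^ 4 / real M)"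
      using M by (simp add: V_def field_simps eval_nat_numeral)
    also have "\<dots> \<le> 256 * (real N ^ 4 * l ^ 4 / real M)" by (intro mult_right_mono) auto
    also have "\<dots> = (4 * real N * l / \<mu>) ^ 4"
      by (simp add: power_mult_distrib power_divide \<mu>4)
    finally show ?thesis
      by (rule power_le_imp_le_base[where n = 3, simplified]) (use \<mu>0 l0 in auto)
  qed
  have "(\<Sum>m\<in>{M<..2 * M} \<inter> odd_squarefree. \<Sum>n\<in>{0<..N div m}. f n m)
    = (\<Sum>m\<in>{M<..2 * M} \<inter> odd_squarefree. (\<Sum>n\<in>{0<..N div (2 * M)}. f n m) + (\<Sum>n\<in>{N div (2 * M)<..N div m}. f n m))"
  proof (intro sum.cong refl)
    fix m assume "m \<in> {M<..2 * M} \<inter> odd_squarefree"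
    then have "N div (2 * M) \<le> N div m" by (intro div_le_mono2) auto
    then have "{0<..N div m} = {0<..N div (2 * M)} \<union> {N div (2 * M)<..N div m}" by auto
    then show "(\<Sum>n\<in>{0<..N div m}. f n m) = (\<Sum>n\<in>{0<..N div (2 * M)}. f n m) + (\<Sum>n\<in>{N div (2 * M)<..N div m}. f n m)"
      by (simp only:, intro sum.union_disjoint) auto
  qed
  also have "norm \<dots> \<le> 4 * real N * l / \<mu> + 14 * real N * l / \<mu>"
    unfolding sum.distrib using rect tri by (intro norm_triangle_le add_mono)
  finally show ?thesis by (simp add: f_def M_def \<mu>_def mult_ac)
qed

section \<open>Summation over dyadic blocks\<close>

lemma sum_dyadic_blocks:
  fixes g :: "nat \<Rightarrow> complex"
  shows "(\<Sum>m\<in>{1<..2 ^ R} \<inter> X. g m) = (\<Sum>k<R. \<Sum>m\<in>{2 ^ k<..2 ^ Suc k} \<inter> X. g m)"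
proof (induction R)
  case (Suc R)
  have "{1<..2 ^ Suc R} \<inter> X = ({1<..2 ^ R} \<inter> X) \<union> ({2 ^ R<..2 ^ Suc R} \<inter> X)"
    using one_le_power[of "2::nat" R] by auto
  then have "(\<Sum>m\<in>{1<..2 ^ Suc R} \<inter> X. g m) = (\<Sum>m\<in>{1<..2 ^ R} \<inter> X. g m) + (\<Sum>m\<in>{2 ^ R<..2 ^ Suc R} \<inter> X. g m)"
    by (simp only:, intro sum.union_disjoint) auto
  then show ?case using Suc by simp
qed simp

text \<open>A geometric series dominated by its first term, at the least \<open>r\<close> with
  \<open>z < 2 ^ Suc r\<close>; this gives the saving in \<open>z\<close> uniformly in the number
  \<open>R\<close> of blocks.\<close>

lemma sum_dyadic_tail_le:
  fixes z :: real
  assumes "z > 0"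
  shows "(\<Sum>k | k < R \<and> z < 2 ^ Suc k. 1 / (2 powr (1 / 4)) ^ k)
    \<le> (2 powr (1 / 4) / (1 - 1 / 2 powr (1 / 4))) / z powr (1 / 4)"
proof -
  obtain j where "z < 2 ^ j" using real_arch_pow[of 2 z] by auto
  also have "(2::real) ^ j \<le> 2 ^ Suc j" by simp
  finally have ex: "\<exists>k. z < 2 ^ Suc k" by blast
  define \<rho> :: real where "\<rho> = 1 / 2 powr (1 / 4)"
  have "(2::real) powr (1 / 4) > 1" by (simp add: gr_one_powr)
  then have \<rho>: "0 < \<rho>" "\<rho> < 1" by (auto simp: \<rho>_def)
  define r where "r = (LEAST k. z < 2 ^ Suc k)"
  have r: "z < 2 ^ Suc r" unfolding r_def using ex by (rule LeastI_ex)
  have min: "r \<le> k" if "z < 2 ^ Suc k" for k unfolding r_def using that by (rule Least_le)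
  have "(\<Sum>k | k < R \<and> z < 2 ^ Suc k. \<rho> ^ k) \<le> (\<Sum>k\<in>{r..<r + R}. \<rho> ^ k)"
    using \<rho> by (intro sum_mono2) (auto dest: min simp del: power_Suc)
  also have "\<dots> = (\<Sum>k<R. \<rho> ^ k * \<rho> ^ r)"
    by (rule sum.reindex_bij_witness[of _ "\<lambda>k. k + r" "\<lambda>k. k - r"]) (auto simp flip: power_add)
  also have "\<dots> = \<rho> ^ r * ((1 - \<rho> ^ R) / (1 - \<rho>))"
    using \<rho> by (simp add: sum_gp_strict mult.commute flip: sum_distrib_right)
  also have "\<dots> \<le> \<rho> ^ r * (1 / (1 - \<rho>))"
    using \<rho> by (intro mult_left_mono divide_right_mono) auto
  also have "\<dots> \<le> (2 powr (1 / 4) / z powr (1 / 4)) * (1 / (1 - \<rho>))"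
  proof (rule mult_right_mono)
    have "z powr (1 / 4) \<le> (2 ^ Suc r) powr (1 / 4)"
      using r assms by (intro powr_mono2) auto
    also have "\<dots> = (2 powr (1 / 4)) ^ Suc r"
    proof -
      have "(2::real) ^ Suc r = 2 powr real (Suc r)" by (rule powr_realpow[symmetric]) simp
      moreover have "((2::real) powr (1 / 4)) ^ Suc r = (2 powr (1 / 4)) powr real (Suc r)"
        by (rule powr_realpow[symmetric]) simp
      ultimately show ?thesis by (simp only: powr_powr mult.commute)
    qed
    also have "\<dots> = 2 powr (1 / 4) / \<rho> ^ r" by (simp add: \<rho>_def power_divide)
    finally show "\<rho> ^ r \<le> 2 powr (1 / 4) / z powr (1 / 4)"
      using \<rho> assms by (simp add: field_simps)
  qed (use \<rho> in simp)
  finally show ?thesis using \<rho> by (simp add: \<rho>_def power_divide mult_ac)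
qed

lemma hyperbola_norm_le:
  fixes z l :: real and N :: nat and a b :: "nat \<Rightarrow> complex"
  assumes z: "z \<ge> 2" and a: "\<And>n. norm (a n) \<le> 1" and b: "\<And>m. norm (b m) \<le> 1"
    and l: "harm (2 * N) \<le> l"
  shows "norm (\<Sum>m\<in>{m. z < real m \<and> m * m \<le> N} \<inter> odd_squarefree. \<Sum>n\<in>{0<..N div m}.
      a n * b m * of_int (Jacobi (int n) m))
    \<le> 18 * (2 powr (1 / 4) / (1 - 1 / 2 powr (1 / 4))) * (real N * l / z powr (1 / 4))"
proof -
  define P where "P = {m. z < real m \<and> m * m \<le> N}"
  \<comment> \<open>The cutoffs in \<open>m\<close> are moved into the coefficients, so that
    complete dyadic blocks can be used.\<close>
  define b' where "b' = (\<lambda>m. if m \<in> P then b m else 0)"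
  define g where "g = (\<lambda>m. \<Sum>n\<in>{0<..N div m}. a n * b' m * of_int (Jacobi (int n) m))"
  have b': "norm (b' m) \<le> 1" for m using b by (simp add: b'_def)
  have l0: "l \<ge> 0" using l harm_nonneg[of "2 * N", where 'a = real] by linarith
  \<comment> \<open>The crude endpoint \<open>2 ^ N\<close> only increases the number of blocks, on
    which the geometric series does not depend.\<close>
  have P: "P \<subseteq> {1<..2 ^ N}"
  proof
    fix m assume m: "m \<in> P"
    then have "1 < m" "m * m \<le> N" using z by (auto simp: P_def)
    moreover have "m \<le> m * m" by simp
    moreover have "N < 2 ^ N" by simp
    ultimately have "1 < m" "m \<le> 2 ^ N" by linarith+
    then show "m \<in> {1<..2 ^ N}" by simp
  qed
  have block: "norm (\<Sum>m\<in>{2 ^ k<..2 ^ Suc k} \<inter> odd_squarefree. g m)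
    \<le> (if z < 2 ^ Suc k then 18 * real N * l * (1 / (2 powr (1 / 4)) ^ k) else 0)" for k
  proof (cases "z < 2 ^ Suc k \<and> 2 ^ k * 2 ^ k \<le> N")
    case True
    then show ?thesis using dyadic_block_norm_le[OF a b', of k N l] l by (simp add: g_def)
  next
    case False
    \<comment> \<open>The block lies entirely at or below \<open>z\<close>, or entirely beyond the
      square root of \<open>N\<close>.\<close>
    have "b' m = 0" if m: "m \<in> {2 ^ k<..2 ^ Suc k}" for m
    proof -
      have "real m \<le> 2 ^ Suc k" using m by (metis greaterThanAtMost_iff of_nat_le_iff of_nat_numeral of_nat_power)
      moreover have "2 ^ k * 2 ^ k \<le> m * m" using m by (intro mult_mono) auto
      ultimately show ?thesis using False by (auto simp: b'_def P_def)
    qed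
    then have "(\<Sum>m\<in>{2 ^ k<..2 ^ Suc k} \<inter> odd_squarefree. g m) = 0"
      unfolding g_def by (intro sum.neutral) auto
    then show ?thesis using l0 by simp
  qed
  have "(\<Sum>m\<in>P \<inter> odd_squarefree. \<Sum>n\<in>{0<..N div m}. a n * b m * of_int (Jacobi (int n) m))
    = (\<Sum>m\<in>{1<..2 ^ N} \<inter> odd_squarefree. g m)"
    using P by (intro sum.mono_neutral_cong_left) (auto simp: g_def b'_def)
  also have "\<dots> = (\<Sum>k<N. \<Sum>m\<in>{2 ^ k<..2 ^ Suc k} \<inter> odd_squarefree. g m)"
    by (rule sum_dyadic_blocks)
  also have "norm \<dots> \<le> (\<Sum>k<N. if z < 2 ^ Suc k then 18 * real N * l * (1 / (2 powr (1 / 4)) ^ k) else 0)"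
    by (intro order.trans[OF norm_sum] sum_mono block)
  also have "\<dots> = 18 * real N * l * (\<Sum>k | k < N \<and> z < 2 ^ Suc k. 1 / (2 powr (1 / 4)) ^ k)"
    unfolding sum_distrib_left by (intro sum.mono_neutral_cong_right) auto
  also have "\<dots> \<le> 18 * real N * l * ((2 powr (1 / 4) / (1 - 1 / 2 powr (1 / 4))) / z powr (1 / 4))"
    using z l0 by (intro mult_left_mono sum_dyadic_tail_le) auto
  finally show ?thesis by (simp add: P_def mult_ac)
qed

section \<open>Reciprocity and the assembly of the bound\<close>

lemma harm_le_4_ln:
  fixes T :: real
  assumes "T \<ge> 2" "real N \<le> T"
  shows "harm (2 * N) \<le> 4 * ln T"
proof (cases "N = 0")
  case True
  then show ?thesis using assms by (simp add: harm_expand)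
next
  case False
  have "harm (2 * N) - ln (real (2 * N)) \<le> (harm 1 - ln (real 1) :: real)"
    using False by (intro euler_mascheroni_sequence_decreasing) auto
  then have "harm (2 * N) \<le> 1 + ln (real (2 * N))" by (simp add: harm_expand)
  also have "ln (real (2 * N)) \<le> ln (2 * T)" using assms False by simp
  also have "ln (2 * T) = ln 2 + ln T" using assms by (simp add: ln_mult)
  finally have "harm (2 * N) \<le> 1 + ln 2 + ln T" by simp
  \<comment> \<open>As 1 <= (3/2) ln 2, the constant 1 + ln 2 is at most 3 ln 2, hence at most 3 ln
    T.\<close>
  moreover have "ln 2 \<le> ln T" using assms by simp
  moreover have "2 / 3 \<le> ln (2::real)" by (rule ln2_ge_two_thirds)
  ultimately show ?thesis by linarith
qed

text \<open>On odd numbers this is the nontrivial Dirichlet character modulo 4. Its norm is 1 at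
  every \<open>n\<close>, so twisting preserves the bounds on coefficients.\<close>

definition character_4 :: "nat \<Rightarrow> complex" where
  "character_4 n = (if n mod 4 = 1 then 1 else - 1)"

text \<open>This separates the variables: the joint sign becomes a combination of four products of a
  function of \<open>n\<close> and a function of \<open>m\<close>.\<close>

lemma reciprocity_sign_eq:
  assumes "odd n" "odd m"
  shows "of_int (reciprocity_sign n m)
    = (1 + character_4 n + character_4 m - character_4 n * character_4 m) / 2"
proof -
  have "n mod 4 = 1 \<or> n mod 4 = 3" "m mod 4 = 1 \<or> m mod 4 = 3" using assms by presburger+
  then show ?thesis by (auto simp: reciprocity_sign_def character_4_def)
qed

text \<open>
  By quadratic reciprocity the roles of the variables can be exchanged, at the price of a sign that
  is a combination of four products of functions of one variable.
\<close>

lemma hyperbola_norm_le_swapped: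
  fixes z l :: real and N :: nat and a b :: "nat \<Rightarrow> complex"
  assumes z: "z \<ge> 2" and a: "\<And>n. norm (a n) \<le> 1" and b: "\<And>m. norm (b m) \<le> 1"
    and b0: "\<And>m. even m \<Longrightarrow> b m = 0" and l: "harm (2 * N) \<le> l"
  shows "norm (\<Sum>n\<in>{n. z < real n \<and> n * n \<le> N} \<inter> odd_squarefree. \<Sum>m\<in>{0<..N div n}.
      a n * b m * of_int (Jacobi (int n) m))
    \<le> 36 * (2 powr (1 / 4) / (1 - 1 / 2 powr (1 / 4))) * (real N * l / z powr (1 / 4))"
proof -
  define B where "B = 18 * (2 powr (1 / 4) / (1 - 1 / 2 powr (1 / 4))) * (real N * l / z powr (1 / 4))"
  define F where "F = (\<lambda>a b :: nat \<Rightarrow> complex. \<Sum>n\<in>{n. z < real n \<and> n * n \<le> N} \<inter> odd_squarefree.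
    \<Sum>m\<in>{0<..N div n}. b m * a n * of_int (Jacobi (int m) n))"
  define a' where "a' = (\<lambda>n. character_4 n * a n)"
  define b' where "b' = (\<lambda>m. character_4 m * b m)"
  have a': "norm (a' n) \<le> 1" and b': "norm (b' n) \<le> 1" for n
    using a b by (auto simp: a'_def b'_def character_4_def norm_mult)
  have F: "norm (F a b) \<le> B" if "\<And>n. norm (a n) \<le> 1" "\<And>n. norm (b n) \<le> 1" for a b
    unfolding F_def B_def by (rule hyperbola_norm_le[OF z that(2,1) l])
  have "(\<Sum>n\<in>{n. z < real n \<and> n * n \<le> N} \<inter> odd_squarefree. \<Sum>m\<in>{0<..N div n}.
      a n * b m * of_int (Jacobi (int n) m))
    = (\<Sum>n\<in>{n. z < real n \<and> n * n \<le> N} \<inter> odd_squarefree. \<Sum>m\<in>{0<..N div n}.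
      (b m * a n * of_int (Jacobi (int m) n) + b m * a' n * of_int (Jacobi (int m) n)
        + b' m * a n * of_int (Jacobi (int m) n) - b' m * a' n * of_int (Jacobi (int m) n)) / 2)"
  proof (intro sum.cong refl)
    fix n m assume n: "n \<in> {n. z < real n \<and> n * n \<le> N} \<inter> odd_squarefree"
    show "a n * b m * of_int (Jacobi (int n) m)
      = (b m * a n * of_int (Jacobi (int m) n) + b m * a' n * of_int (Jacobi (int m) n)
        + b' m * a n * of_int (Jacobi (int m) n) - b' m * a' n * of_int (Jacobi (int m) n)) / 2"
    proof (cases "odd m")
      case True
      have "odd n" using n by (simp add: odd_squarefree_def)
      then have eq: "complex_of_int (Jacobi (int n) m)
        = (1 + character_4 n + character_4 m - character_4 n * character_4 m) / 2 * of_int (Jacobi (int m) n)"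
        using True by (subst Jacobi_reciprocity) (simp_all add: reciprocity_sign_eq)
      show ?thesis unfolding eq by (simp add: a'_def b'_def field_simps)
    qed (simp add: b0 b'_def)
  qed
  also have "\<dots> = (F a b + F a' b + F a b' - F a' b') / 2"
    by (simp only: F_def sum.distrib sum_subtractf flip: sum_divide_distrib)
  \<comment> \<open>Four twisted sums with weight 1/2 each double the constant 18 to 36.\<close>
  also have "norm \<dots> \<le> (B + B + B + B) / 2"
  proof -
    have "norm (F a b + F a' b + F a b' - F a' b') \<le> B + B + B + B"
      using F[OF a b] F[OF a' b] F[OF a b'] F[OF a' b']
      by (intro norm_triangle_le_diff norm_triangle_le add_mono)
    then show ?thesis by (simp add: norm_divide)
  qed
  also have "\<dots> = 2 * B" by simp
  finally show ?thesis by (simp add: B_def mult_ac)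
qed

theorem theorem1p2:
  shows "\<exists>C::real. C > 0 \<and>
    (\<forall>(T::real) (z::real) (a :: nat \<Rightarrow> complex) (b :: nat \<Rightarrow> complex).
      T \<ge> 2 \<longrightarrow> z \<ge> 2 \<longrightarrow>
      (\<forall>n\<ge>1. norm (a n) \<le> 1) \<longrightarrow> (\<forall>m\<ge>1. norm (b m) \<le> 1) \<longrightarrow>
      norm (\<Sum>(n, m) \<in> {(n, m). odd n \<and> squarefree n \<and> odd m \<and> squarefree m \<and>
                z < real n \<and> real n \<le> T \<and> z < real m \<and> real m \<le> T \<and> real (n * m) \<le> T}.
              a n * b m * of_int (Jacobi (int n) m))
        \<le> C * (T * ln T / z powr (1 / 4)))"
proof -
  define c :: real where "c = 2 powr (1 / 4) / (1 - 1 / 2 powr (1 / 4))"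
  have "(2::real) powr (1 / 4) > 1" by (simp add: gr_one_powr)
  then have c: "c > 0" by (simp add: c_def)
  show ?thesis
  \<comment> \<open>The two halves of the region contribute 18 and 36, and the harmonic sum is
    bounded by 4 ln T; 54 * 4 = 216.\<close>
  proof (intro exI[of _ "216 * c"] conjI allI impI)
    show "216 * c > 0" using c by simp
    fix T z :: real and a b :: "nat \<Rightarrow> complex"
    assume T: "T \<ge> 2" and z: "z \<ge> 2" and a: "\<forall>n\<ge>1. norm (a n) \<le> 1" and b: "\<forall>m\<ge>1. norm (b m) \<le> 1"
    define N where "N = nat \<lfloor>T\<rfloor>"
    have N_iff: "real k \<le> T \<longleftrightarrow> k \<le> N" for k unfolding N_def using T by (simp add: le_nat_iff le_floor_iff)
    have N: "real N \<le> T" using N_iff by blast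
    define l where "l = 4 * ln T"
    have l: "harm (2 * N) \<le> l" unfolding l_def by (rule harm_le_4_ln[OF T N])
    have l0: "l \<ge> 0" using T by (simp add: l_def)
    define f where "f = (\<lambda>n m. a n * b m * of_int (Jacobi (int n) m))"
    define R where "R = {(n, m). n \<in> odd_squarefree \<and> m \<in> odd_squarefree \<and> z < real n \<and> z < real m \<and> n * m \<le> N}"
    define P where "P = {m. z < real m \<and> m * m \<le> N} \<inter> odd_squarefree"
    have le_N: "n \<le> N \<and> m \<le> N" if "n * m \<le> N" "z < real n" "z < real m" for n m
    proof -
      have "0 < n" "0 < m" using that z by (auto intro!: Nat.gr0I)
      then have "n \<le> n * m" "m \<le> n * m" by auto
      with that(1) show ?thesis by linarith
    qed
    have fin: "finite R"
      by (rule finite_subset[of _ "{..N} \<times> {..N}"]) (auto simp: R_def dest: le_N)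
    have finP: "finite P"
      by (rule finite_subset[of _ "{..N}"]) (auto simp: P_def intro: order.trans[OF le_square])
    have div_iff: "n \<in> {0<..N div m} \<longleftrightarrow> 0 < n \<and> n * m \<le> N" if "m > 0" for n m
      using that by (auto simp: less_eq_div_iff_mult_less_eq)
    have Pz: "m > 0" if "m \<in> P" for m using that z by (auto simp: P_def intro!: Nat.gr0I)
    have "{(n, m). odd n \<and> squarefree n \<and> odd m \<and> squarefree m \<and>
        z < real n \<and> real n \<le> T \<and> z < real m \<and> real m \<le> T \<and> real (n * m) \<le> T} = R"
      unfolding R_def odd_squarefree_def N_iff using le_N by blast
    then have "(\<Sum>(n, m) \<in> {(n, m). odd n \<and> squarefree n \<and> odd m \<and> squarefree m \<and>
        z < real n \<and> real n \<le> T \<and> z < real m \<and> real m \<le> T \<and> real (n * m) \<le> T}.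
        a n * b m * of_int (Jacobi (int n) m)) = (\<Sum>(n, m)\<in>R. f n m)"
      by (simp add: f_def)
    \<comment> \<open>At least one variable is at most the square root of \<open>N\<close>. The
      first part has \<open>m\<close> there; in the second \<open>m\<close> exceeds it, which forces
      \<open>n * n \<le> N\<close>.\<close>
    also have "\<dots> = (\<Sum>(n, m)\<in>{(n, m) \<in> R. m * m \<le> N}. f n m) + (\<Sum>(n, m)\<in>{(n, m) \<in> R. N < m * m}. f n m)"
      by (subst sum.union_disjoint[symmetric]) (auto intro!: sum.cong finite_subset[OF _ fin])
    also have "norm \<dots> \<le> 18 * c * (real N * l / z powr (1 / 4)) + 36 * c * (real N * l / z powr (1 / 4))"
    proof (intro norm_triangle_le add_mono)
      \<comment> \<open>The remaining conditions on \<open>n\<close> go into the coefficient. The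
        cutoff at \<open>z\<close> also bounds it at 0, where nothing is assumed about
        \<open>a\<close>.\<close>
      define a' where "a' = (\<lambda>n. if z < real n \<and> n \<in> odd_squarefree then a n else 0)"
      have a': "norm (a' n) \<le> 1" for n using a z by (auto simp: a'_def)
      define b' where "b' = (\<lambda>m. if m \<in> P then b m else 0)"
      have b': "norm (b' m) \<le> 1" for m using b Pz by (auto simp: b'_def Suc_le_eq)
      have "(\<Sum>(n, m)\<in>{(n, m) \<in> R. m * m \<le> N}. f n m)
        = (\<Sum>(m, n)\<in>{(m, n). (n, m) \<in> R \<and> m * m \<le> N}. f n m)"
        by (rule sum.reindex_bij_witness[of _ "\<lambda>(m, n). (n, m)" "\<lambda>(n, m). (m, n)"]) auto
      also have "\<dots> = (\<Sum>(m, n)\<in>Sigma P (\<lambda>m. {0<..N div m}). a' n * b' m * of_int (Jacobi (int n) m))"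
      proof (rule sum.mono_neutral_cong_left)
        show "finite (Sigma P (\<lambda>m. {0<..N div m}))" using finP by auto
        show "{(m, n). (n, m) \<in> R \<and> m * m \<le> N} \<subseteq> Sigma P (\<lambda>m. {0<..N div m})"
          using z by (auto simp: R_def P_def less_eq_div_iff_mult_less_eq)
        show "\<forall>p\<in>Sigma P (\<lambda>m. {0<..N div m}) - {(m, n). (n, m) \<in> R \<and> m * m \<le> N}.
            (case p of (m, n) \<Rightarrow> a' n * b' m * of_int (Jacobi (int n) m)) = 0"
          using z by (auto simp: a'_def R_def P_def less_eq_div_iff_mult_less_eq split: if_splits)
      qed (auto simp: f_def a'_def b'_def R_def P_def)
      also have "\<dots> = (\<Sum>m\<in>P. \<Sum>n\<in>{0<..N div m}. a' n * b' m * of_int (Jacobi (int n) m))"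
        using finP by (simp add: sum.Sigma)
      finally show "norm (\<Sum>(n, m)\<in>{(n, m) \<in> R. m * m \<le> N}. f n m) \<le> 18 * c * (real N * l / z powr (1 / 4))"
        unfolding c_def P_def using hyperbola_norm_le[OF z a' b' l] by simp
    next
      define a' where "a' = (\<lambda>n. if n \<in> P then a n else 0)"
      have a': "norm (a' n) \<le> 1" for n using a Pz by (auto simp: a'_def Suc_le_eq)
      \<comment> \<open>The support on odd \<open>m\<close> is what permits reciprocity, and
        \<open>N < m * m\<close> prevents counting the first part again.\<close>
      define b' where "b' = (\<lambda>m. if z < real m \<and> N < m * m \<and> m \<in> odd_squarefree then b m else 0)"
      have b': "norm (b' m) \<le> 1" for m using b z by (auto simp: b'_def)
      have b0: "b' m = 0" if "even m" for m using that by (simp add: b'_def odd_squarefree_def)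
      have sq: "n * n \<le> N" if "n * m \<le> N" "N < m * m" for n m :: nat
      proof -
        have "n * m < m * m" using that by linarith
        then have "n \<le> m" by simp
        then have "n * n \<le> n * m" by simp
        with that show ?thesis by linarith
      qed
      have "(\<Sum>(n, m)\<in>{(n, m) \<in> R. N < m * m}. f n m)
        = (\<Sum>(n, m)\<in>Sigma P (\<lambda>n. {0<..N div n}). a' n * b' m * of_int (Jacobi (int n) m))"
      proof (rule sum.mono_neutral_cong_left)
        show "finite (Sigma P (\<lambda>n. {0<..N div n}))" using finP by auto
        show "{(n, m) \<in> R. N < m * m} \<subseteq> Sigma P (\<lambda>n. {0<..N div n})"
          using z by (auto simp: R_def P_def less_eq_div_iff_mult_less_eq mult.commute intro: sq)
        show "\<forall>p\<in>Sigma P (\<lambda>n. {0<..N div n}) - {(n, m) \<in> R. N < m * m}.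
            (case p of (n, m) \<Rightarrow> a' n * b' m * of_int (Jacobi (int n) m)) = 0"
          using z by (auto simp: b'_def R_def P_def less_eq_div_iff_mult_less_eq mult.commute split: if_splits)
      qed (auto simp: f_def a'_def b'_def R_def P_def intro: sq)
      also have "\<dots> = (\<Sum>n\<in>P. \<Sum>m\<in>{0<..N div n}. a' n * b' m * of_int (Jacobi (int n) m))"
        using finP by (simp add: sum.Sigma)
      finally show "norm (\<Sum>(n, m)\<in>{(n, m) \<in> R. N < m * m}. f n m) \<le> 36 * c * (real N * l / z powr (1 / 4))"
        unfolding c_def P_def using hyperbola_norm_le_swapped[OF z a' b' b0 l] by simp
    qed
    also have "\<dots> = 54 * c * (real N * l / z powr (1 / 4))" by simp
    also have "\<dots> \<le> 54 * c * (T * l / z powr (1 / 4))"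
      using c N l0 by (intro mult_left_mono divide_right_mono mult_right_mono) auto
    also have "\<dots> = 216 * c * (T * ln T / z powr (1 / 4))" by (simp add: l_def)
    finally show "norm (\<Sum>(n, m) \<in> {(n, m). odd n \<and> squarefree n \<and> odd m \<and> squarefree m \<and>
        z < real n \<and> real n \<le> T \<and> z < real m \<and> real m \<le> T \<and> real (n * m) \<le> T}.
        a n * b m * of_int (Jacobi (int n) m)) \<le> 216 * c * (T * ln T / z powr (1 / 4))" .
  qed
qed

end
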